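(* Let $n$ be a nonnegative integer, let $\alpha>n$, and let $f_0,\dots,f_n$ be linearly independent functions in $A^\alpha$. If $g=\sum_{j=0}^n\lambda_jf_j$ is a nontrivial linear combination of the $f_j$'s (i.e., the $\lambda_j\in\mathbb{C}$ are not all zero), and if $\theta$ is an inner function such that $g$ is strongly multipliable by $\theta$ in $A^\alpha$, then the Wronskian $W:=W(f_0,\dots,f_n)$ is strongly multipliable by $\theta$ in $A^{\alpha-n}$.
   Context: $\mathbb{D}=\{z\in\mathbb{C}:|z|<1\}$, $\mathbb{T}=\partial\mathbb{D}$. For $\alpha>0$, $A^\alpha$ is the set of all holomorphic $f$ on $\mathbb{D}$ with $\sup_{z\in\mathbb{D}}|f^{(m)}(z)|(1-|z|)^{m-\alpha}<\infty$, where $m$ is the least integer in $(\alpha,\infty)$. A bounded holomorphic function $\theta$ on $\mathbb{D}$ is inner if $\lim_{r\to1^-}|\theta(r\zeta)|=1$ for almost all $\zeta\in\mathbb{T}$. For $\alpha>0$, $f\in A^\alpha$ and $\theta$ inner, $f$ is strongly multipliable by $\theta$ in $A^\alpha$ if $f\theta^k\in A^\alpha$ for all positive integers $k$. The Wronskian is $W(f_0,\dots,f_n)=\det\left(f_j^{(k)}\right)_{0\le k,j\le n}$ ($k$ the row index, $j$ the column index). *)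

theory Defs
  imports "HOL-Complex_Analysis.Complex_Analysis" "Jordan_Normal_Form.Determinant"
begin

text \<open>
  Functions on the unit disc are total functions on the complex numbers of which only the values
  on \<open>ball 0 1\<close> matter. The class \<open>A_class \<alpha>\<close> is meant for \<open>\<alpha> > 0\<close> only.
\<close>

definition A_class :: "real \<Rightarrow> (complex \<Rightarrow> complex) set" where
  "A_class \<alpha> = {f. f holomorphic_on ball 0 1 \<and>
     (let m = (LEAST m::nat. \<alpha> < real m) in
      bdd_above ((\<lambda>z. norm ((deriv ^^ m) f z) * (1 - norm z) powr (real m - \<alpha>)) ` ball 0 1))}"

text \<open>
  A property holds almost everywhere on the unit circle if it holds at \<open>cis t\<close> for
  Lebesgue-almost all \<open>t\<close> in \<open>{0..2 * pi}\<close>.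
\<close>

definition inner_function :: "(complex \<Rightarrow> complex) \<Rightarrow> bool" where
  "inner_function \<theta> \<longleftrightarrow>
     \<theta> holomorphic_on ball 0 1 \<and> bounded (\<theta> ` ball 0 1) \<and>
     (AE t in lebesgue_on {0..2 * pi}.
        ((\<lambda>r::real. norm (\<theta> (of_real r * cis t))) \<longlongrightarrow> 1) (at_left 1))"

definition strongly_multipliable ::
    "real \<Rightarrow> (complex \<Rightarrow> complex) \<Rightarrow> (complex \<Rightarrow> complex) \<Rightarrow> bool" where
  "strongly_multipliable \<alpha> f \<theta> \<longleftrightarrow>
     0 < \<alpha> \<and> f \<in> A_class \<alpha> \<and> inner_function \<theta> \<and>
     (\<forall>k::nat. 0 < k \<longrightarrow> (\<lambda>z. f z * \<theta> z ^ k) \<in> A_class \<alpha>)"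

text \<open>
  Linear independence over the complex numbers of the family \<open>f 0, \<dots>, f n\<close> of functions on the disc.
\<close>

definition lin_indep_on_disc :: "nat \<Rightarrow> (nat \<Rightarrow> complex \<Rightarrow> complex) \<Rightarrow> bool" where
  "lin_indep_on_disc n f \<longleftrightarrow>
     (\<forall>c::nat \<Rightarrow> complex. (\<forall>z\<in>ball 0 1. (\<Sum>j\<le>n. c j * f j z) = 0) \<longrightarrow> (\<forall>j\<le>n. c j = 0))"

definition wronskian :: "nat \<Rightarrow> (nat \<Rightarrow> complex \<Rightarrow> complex) \<Rightarrow> complex \<Rightarrow> complex" where
  "wronskian n f z =
     Determinant.det (mat (Suc n) (Suc n) (\<lambda>(k, j). (deriv ^^ k) (f j) z))"

end

theory Submission
  imports Defs
begin

text \<open>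
  Let \<open>c q \<noteq> 0\<close>. Replacing column \<open>q\<close> of the Wronskian matrix by the same linear combination of its
  columns that defines \<open>g\<close> multiplies the determinant by \<open>c q\<close> and turns that column into
  \<open>g, g', \<dots>, g^(n)\<close>. Expanding along it, \<open>c q * W * \<theta> ^ k\<close> is the sum over \<open>i \<le> n\<close> of
  \<open>g^(i) * \<theta> ^ k\<close> times a cofactor. The cofactors are polynomials in derivatives
  \<open>f_j^(l)\<close> with \<open>l \<le> n\<close>, which lie in the class of order \<open>\<alpha> - n\<close>; for positive order
  these classes are algebras and decrease as the order grows (\<open>A_class_mult\<close>,
  \<open>A_class_mono\<close>). So all that is needed is that \<open>g^(i) * \<theta> ^ k\<close> has order \<open>\<alpha> - i\<close>.

  By induction on \<open>i\<close> this is the step from \<open>g\<close> to \<open>g'\<close> (\<open>derivative_times_inner_powers\<close>).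
  Let \<open>F_K = \<theta> ^ (k - 1) * (g' * \<theta> + K * g * \<theta>')\<close>. Then \<open>F_k = (g * \<theta> ^ k)'\<close> and
  \<open>F_(k+1) * \<theta> = (g * \<theta> ^ (k + 1))'\<close> have order \<open>\<alpha> - 1\<close>, and
  \<open>g' * \<theta> ^ k = (k + 1) * F_k - k * F_(k+1)\<close>. It remains to cancel the factor \<open>\<theta>\<close>.

  The cancellation (\<open>A_class_divide_inner\<close>) holds for every bounded holomorphic \<open>F\<close>: if \<open>F * \<theta>\<close>
  has order \<open>\<beta>\<close>, so has \<open>F\<close>. Since \<open>\<bar>\<theta>\<bar> = 1\<close> almost everywhere on the circle, \<open>F\<close> is the Cauchy integral of
  \<open>h * cnj \<theta>\<close> with \<open>h = F * \<theta>\<close>; on circles of radius \<open>R < 1\<close> this holds up to an error that vanishes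
  as \<open>R\<close> tends to 1, so that no boundary values are needed. What makes multiplication by
  \<open>cnj \<theta>\<close> harmless is \<open>pairing_bound\<close>. There the \<open>m\<close>-th derivative of the Cauchy integral is written
  as the pairing of \<open>h\<close> with \<open>\<zeta> ^ m * \<kappa>(\<zeta>)\<close>, where \<open>\<kappa>\<close> is \<open>\<theta>\<close> times a Cauchy kernel. Taylor's formula
  along radii replaces \<open>h\<close> by its \<open>m\<close>-th derivative at \<open>r * \<zeta>\<close>, because the Taylor polynomial pairs
  to 0 with \<open>\<zeta> ^ m * \<kappa>(\<zeta>)\<close>. A pairing of two holomorphic functions depends only on the product of the
  radii at which they are taken, so the radius \<open>r\<close> can be shared equally:
  both the derivative and the kernel are then evaluated at \<open>sqrt r * \<zeta>\<close>, where each is controlled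
  by its distance to the circle.
\<close>

section \<open>Growth of holomorphic functions at the unit circle\<close>

text \<open>
  The condition that a derivative of a Lipschitz-Zygmund function satisfies, with the exponent as
  a free parameter, so that derivatives of all orders can be handled uniformly.
\<close>

definition growth :: "real \<Rightarrow> (complex \<Rightarrow> complex) \<Rightarrow> bool" where
  "growth \<gamma> F \<longleftrightarrow> (\<exists>C. \<forall>z\<in>ball 0 1. norm (F z) \<le> C * (1 - norm z) powr (- \<gamma>))"

lemma growthE:
  assumes "growth \<gamma> F"
  obtains C where "C > 0" "\<And>z. z \<in> ball 0 1 \<Longrightarrow> norm (F z) \<le> C * (1 - norm z) powr (- \<gamma>)"
proof -
  obtain C where C: "\<And>z. z \<in> ball 0 1 \<Longrightarrow> norm (F z) \<le> C * (1 - norm z) powr (- \<gamma>)"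
    using assms unfolding growth_def by blast
  have "norm (F z) \<le> (\<bar>C\<bar> + 1) * (1 - norm z) powr (- \<gamma>)" if "z \<in> ball 0 1" for z
  proof -
    have "C * (1 - norm z) powr (- \<gamma>) \<le> (\<bar>C\<bar> + 1) * (1 - norm z) powr (- \<gamma>)"
      by (intro mult_right_mono) auto
    with C[OF that] show ?thesis by linarith
  qed
  then show thesis by (intro that[of "\<bar>C\<bar> + 1"]) auto
qed

lemma growth_cong:
  assumes "growth \<gamma> F" "\<And>z. z \<in> ball 0 1 \<Longrightarrow> F z = G z"
  shows "growth \<gamma> G"
  using assms by (simp add: growth_def)

lemma growth_mono:
  assumes "growth \<gamma> F" "\<gamma> \<le> \<gamma>'"
  shows "growth \<gamma>' F"
proof -
  obtain C where "C > 0" and C: "\<And>z. z \<in> ball 0 1 \<Longrightarrow> norm (F z) \<le> C * (1 - norm z) powr (- \<gamma>)"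
    using growthE[OF assms(1)] by blast
  have "norm (F z) \<le> C * (1 - norm z) powr (- \<gamma>')" if z: "z \<in> ball 0 1" for z
  proof -
    have "(1 - norm z) powr (- \<gamma>) \<le> (1 - norm z) powr (- \<gamma>')"
      using z assms(2) by (intro powr_mono') auto
    then show ?thesis using C[OF z] \<open>C > 0\<close> by (smt (verit) mult_left_mono)
  qed
  then show ?thesis unfolding growth_def by blast
qed

lemma growth_0_iff: "growth 0 F \<longleftrightarrow> bounded (F ` ball 0 1)"
proof -
  have "(1 - norm z) powr 0 = 1" if "z \<in> ball 0 1" for z :: complex
    using that by auto
  then show ?thesis by (simp add: growth_def bounded_iff)
qed

lemma growth_add:
  assumes "growth \<gamma> F" "growth \<gamma> G"
  shows "growth \<gamma> (\<lambda>z. F z + G z)"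
proof -
  obtain C D where C: "\<And>z. z \<in> ball 0 1 \<Longrightarrow> norm (F z) \<le> C * (1 - norm z) powr (- \<gamma>)"
    and D: "\<And>z. z \<in> ball 0 1 \<Longrightarrow> norm (G z) \<le> D * (1 - norm z) powr (- \<gamma>)"
    using assms unfolding growth_def by blast
  have "norm (F z + G z) \<le> (C + D) * (1 - norm z) powr (- \<gamma>)" if z: "z \<in> ball 0 1" for z
    using norm_triangle_ineq[of "F z" "G z"] C[OF z] D[OF z] unfolding distrib_right by linarith
  then show ?thesis unfolding growth_def by blast
qed

lemma growth_mult:
  assumes "growth \<gamma> F" "growth \<delta> G"
  shows "growth (\<gamma> + \<delta>) (\<lambda>z. F z * G z)"
proof -
  obtain C where "C > 0" and C: "\<And>z. z \<in> ball 0 1 \<Longrightarrow> norm (F z) \<le> C * (1 - norm z) powr (- \<gamma>)"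
    using growthE[OF assms(1)] by blast
  obtain D where "D > 0" and D: "\<And>z. z \<in> ball 0 1 \<Longrightarrow> norm (G z) \<le> D * (1 - norm z) powr (- \<delta>)"
    using growthE[OF assms(2)] by blast
  have "norm (F z * G z) \<le> (C * D) * (1 - norm z) powr (- (\<gamma> + \<delta>))" if z: "z \<in> ball 0 1" for z
  proof -
    have "norm (F z * G z) \<le> (C * (1 - norm z) powr (- \<gamma>)) * (D * (1 - norm z) powr (- \<delta>))"
      unfolding norm_mult using C[OF z] D[OF z] \<open>C > 0\<close> \<open>D > 0\<close> by (intro mult_mono) auto
    also have "\<dots> = (C * D) * (1 - norm z) powr (- (\<gamma> + \<delta>))"
      using powr_add[of "1 - norm z" "- \<gamma>" "- \<delta>"] by (simp add: algebra_simps)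
    finally show ?thesis .
  qed
  then show ?thesis unfolding growth_def by blast
qed

lemma growth_const: "\<gamma> \<ge> 0 \<Longrightarrow> growth \<gamma> (\<lambda>z. a)"
  by (rule growth_mono[of 0]) (auto simp: growth_0_iff bounded_iff)

lemma growth_sum:
  assumes "finite I" "\<And>i. i \<in> I \<Longrightarrow> growth \<gamma> (F i)"
  shows "growth \<gamma> (\<lambda>z. \<Sum>i\<in>I. F i z)"
  using assms
proof (induction I rule: finite_induct)
  case empty
  then show ?case by (auto simp: growth_def intro: exI[of _ 0])
qed (auto intro: growth_add)

text \<open>
  Integration of the bound on the derivative along the radius; the right-hand side comes from the
  primitive of \<open>s \<mapsto> (1 - s * norm z) powr (- \<gamma>)\<close>. The value
  \<open>\<gamma> = 1\<close> would give a logarithm; it is avoided by enlarging the exponent.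
\<close>

lemma radial_primitive_bound:
  fixes F :: "complex \<Rightarrow> complex"
  assumes hol: "F holomorphic_on ball 0 1" and "\<gamma> \<noteq> 1"
    and C: "C \<ge> 0" "\<And>z. z \<in> ball 0 1 \<Longrightarrow> norm (deriv F z) \<le> C * (1 - norm z) powr (- \<gamma>)"
    and z: "z \<in> ball 0 1"
  shows "norm (F z) \<le> norm (F 0) + C * ((1 - norm z) powr (1 - \<gamma>) - 1) / (\<gamma> - 1)"
proof -
  define \<phi> where "\<phi> s = C / (\<gamma> - 1) * (1 - s * norm z) powr (1 - \<gamma>)" for s :: real
  have inball: "of_real s * z \<in> ball 0 1" if "s \<in> {0..1}" for s :: real
  proof -
    have "s * norm z \<le> 1 * norm z" using that by (intro mult_right_mono) auto
    then show ?thesis using z that by (auto simp: norm_mult)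
  qed
  have pos: "1 - s * norm z > 0" if "s \<in> {0..1}" for s :: real
    using inball[OF that] that by (auto simp: norm_mult)
  have dF: "((\<lambda>s. F (of_real s * z)) has_vector_derivative z * deriv F (of_real s * z)) (at s)"
    if "s \<in> {0..1}" for s
  proof -
    have "(F has_field_derivative deriv F (of_real s * z)) (at (of_real s * z))"
      using hol inball[OF that] by (intro holomorphic_derivI[of _ "ball 0 1"]) auto
    moreover have "((\<lambda>s. of_real s * z) has_vector_derivative z) (at s)"
      by (auto intro!: derivative_eq_intros)
    ultimately show ?thesis
      using field_vector_diff_chain_at[of "\<lambda>s. of_real s * z" z s F] by (simp add: o_def)
  qed
  have d\<phi>: "(\<phi> has_vector_derivative C * norm z * (1 - s * norm z) powr (- \<gamma>)) (at s)"
    if "s \<in> {0..1}" for s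
  proof -
    have "(\<phi> has_real_derivative
        C / (\<gamma> - 1) * ((1 - \<gamma>) * (1 - s * norm z) powr (1 - \<gamma> - 1) * (- norm z))) (at s)"
      unfolding \<phi>_def using pos[OF that] \<open>\<gamma> \<noteq> 1\<close> by (auto intro!: derivative_eq_intros)
    also have "C / (\<gamma> - 1) * ((1 - \<gamma>) * (1 - s * norm z) powr (1 - \<gamma> - 1) * (- norm z)) =
        C * norm z * (1 - s * norm z) powr (- \<gamma>)"
      using \<open>\<gamma> \<noteq> 1\<close> by (simp add: divide_simps) (simp add: algebra_simps)
    finally show ?thesis unfolding has_real_derivative_iff_has_vector_derivative .
  qed
  have "norm (F (of_real 1 * z) - F (of_real 0 * z)) \<le> \<phi> 1 - \<phi> 0"
  proof (rule differentiable_bound_general[where f = "\<lambda>s. F (of_real s * z)"])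
    show "continuous_on {0..1} (\<lambda>s. F (of_real s * z))"
      using dF by (meson continuous_at_imp_continuous_on has_vector_derivative_continuous)
    show "continuous_on {0..1} \<phi>"
      using d\<phi> by (meson continuous_at_imp_continuous_on has_vector_derivative_continuous)
    fix s :: real assume s: "0 < s" "s < 1"
    show "((\<lambda>s. F (of_real s * z)) has_vector_derivative z * deriv F (of_real s * z)) (at s)"
      using s by (intro dF) auto
    show "(\<phi> has_vector_derivative C * norm z * (1 - s * norm z) powr (- \<gamma>)) (at s)"
      using s by (intro d\<phi>) auto
    have "norm (deriv F (of_real s * z)) \<le> C * (1 - norm (of_real s * z)) powr (- \<gamma>)"
      using s by (intro C(2) inball) auto
    then show "norm (z * deriv F (of_real s * z)) \<le> C * norm z * (1 - s * norm z) powr (- \<gamma>)"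
      using s mult_left_mono[of "norm (deriv F (of_real s * z))" "C * (1 - s * norm z) powr (- \<gamma>)" "norm z"]
      by (simp add: norm_mult mult_ac)
  qed auto
  then have "norm (F z - F 0) \<le> C * ((1 - norm z) powr (1 - \<gamma>) - 1) / (\<gamma> - 1)"
    using z by (auto simp: \<phi>_def diff_divide_distrib right_diff_distrib)
  then show ?thesis using norm_triangle_ineq2[of "F z" "F 0"] by linarith
qed

text \<open>
  Integration gains one power of the distance to the circle, as long as the resulting exponent
  stays positive.
\<close>

lemma growth_of_deriv:
  assumes hol: "F holomorphic_on ball 0 1" and "growth (1 + \<epsilon>) (deriv F)" and "\<epsilon> > 0"
  shows "growth \<epsilon> F"
proof -
  obtain C where C: "C > 0" "\<And>z. z \<in> ball 0 1 \<Longrightarrow> norm (deriv F z) \<le> C * (1 - norm z) powr (- (1 + \<epsilon>))"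
    using growthE[OF assms(2)] by blast
  have "growth \<epsilon> (\<lambda>z. of_real (norm (F 0) + C / \<epsilon> * (1 - norm z) powr (- \<epsilon>)))"
  proof (rule growth_cong[OF growth_add])
    show "growth \<epsilon> (\<lambda>z. of_real (norm (F 0)))" using \<open>\<epsilon> > 0\<close> by (intro growth_const) auto
    show "growth \<epsilon> (\<lambda>z. of_real (C / \<epsilon> * (1 - norm z) powr (- \<epsilon>)))"
      using C(1) \<open>\<epsilon> > 0\<close> unfolding growth_def by (intro exI[of _ "C / \<epsilon>"]) (auto simp: norm_mult norm_divide)
  qed auto
  then obtain D where D: "\<And>z::complex. z \<in> ball 0 1 \<Longrightarrow>
      norm (of_real (norm (F 0) + C / \<epsilon> * (1 - norm z) powr (- \<epsilon>)) :: complex) \<le> D * (1 - norm z) powr (- \<epsilon>)"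
    unfolding growth_def by blast
  have "norm (F z) \<le> D * (1 - norm z) powr (- \<epsilon>)" if z: "z \<in> ball 0 1" for z
  proof -
    have "norm (F z) \<le> norm (F 0) + C * ((1 - norm z) powr (1 - (1 + \<epsilon>)) - 1) / (1 + \<epsilon> - 1)"
      using C z \<open>\<epsilon> > 0\<close> by (intro radial_primitive_bound[OF hol]) auto
    also have "\<dots> \<le> norm (F 0) + C / \<epsilon> * (1 - norm z) powr (- \<epsilon>)"
      using C(1) \<open>\<epsilon> > 0\<close> by (simp add: field_simps)
    also have "\<dots> \<le> D * (1 - norm z) powr (- \<epsilon>)"
      using D[OF z] unfolding norm_of_real by linarith
    finally show ?thesis .
  qed
  then show ?thesis unfolding growth_def by blast
qed

text \<open>
  Here the exponent is integrable, so nothing is lost at the circle.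
\<close>

lemma bounded_of_deriv_growth:
  assumes hol: "F holomorphic_on ball 0 1" and "growth \<gamma> (deriv F)" and "\<gamma> < 1"
  shows "growth 0 F"
proof -
  obtain C where C: "C > 0" "\<And>z. z \<in> ball 0 1 \<Longrightarrow> norm (deriv F z) \<le> C * (1 - norm z) powr (- \<gamma>)"
    using growthE[OF assms(2)] by blast
  have "norm (F z) \<le> norm (F 0) + C / (1 - \<gamma>)" if z: "z \<in> ball 0 1" for z
  proof -
    have "norm (F z) \<le> norm (F 0) + C * ((1 - norm z) powr (1 - \<gamma>) - 1) / (\<gamma> - 1)"
      using C z \<open>\<gamma> < 1\<close> by (intro radial_primitive_bound[OF hol]) auto
    also have "C * ((1 - norm z) powr (1 - \<gamma>) - 1) / (\<gamma> - 1) = C * (1 - (1 - norm z) powr (1 - \<gamma>)) / (1 - \<gamma>)"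
      using \<open>\<gamma> < 1\<close> by (simp add: divide_simps) (simp add: algebra_simps)
    also have "\<dots> \<le> C * 1 / (1 - \<gamma>)"
      using C(1) \<open>\<gamma> < 1\<close> by (intro divide_right_mono mult_left_mono) auto
    finally show ?thesis by simp
  qed
  then show ?thesis unfolding growth_0_iff bounded_iff by blast
qed

section \<open>The classes of holomorphic Lipschitz-Zygmund functions\<close>

definition least_nat_above :: "real \<Rightarrow> nat" where
  "least_nat_above \<alpha> = (LEAST m::nat. \<alpha> < real m)"

lemma least_nat_above:
  assumes "\<alpha> \<ge> 0"
  shows "\<alpha> < real (least_nat_above \<alpha>)" "real (least_nat_above \<alpha>) \<le> \<alpha> + 1" "least_nat_above \<alpha> > 0"
proof -
  obtain N :: nat where "\<alpha> < real N" using reals_Archimedean2 by blast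
  then show *: "\<alpha> < real (least_nat_above \<alpha>)" unfolding least_nat_above_def by (rule LeastI)
  with assms show pos: "least_nat_above \<alpha> > 0" by (cases "least_nat_above \<alpha>") auto
  have "\<not> \<alpha> < real (least_nat_above \<alpha> - 1)"
    using pos unfolding least_nat_above_def by (intro not_less_Least) auto
  then show "real (least_nat_above \<alpha>) \<le> \<alpha> + 1" using pos by (auto simp: of_nat_diff)
qed

lemma least_nat_above_Suc:
  assumes "\<alpha> > 0"
  shows "least_nat_above (\<alpha> + 1) = Suc (least_nat_above \<alpha>)"
  using least_nat_above[of \<alpha>] least_nat_above[of "\<alpha> + 1"] assms by linarith

lemma A_class_iff:
  "f \<in> A_class \<alpha> \<longleftrightarrow> f holomorphic_on ball 0 1 \<and>
     growth (real (least_nat_above \<alpha>) - \<alpha>) ((deriv ^^ least_nat_above \<alpha>) f)"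
proof -
  have eq: "norm x * (1 - norm z) powr a \<le> C \<longleftrightarrow> norm x \<le> C * (1 - norm z) powr (- a)"
    if "z \<in> ball 0 1" for x z :: complex and a C :: real
    using that by (simp add: powr_minus field_simps)
  show ?thesis
    unfolding A_class_def growth_def bdd_above_def least_nat_above_def[symmetric] Let_def
    by (auto simp: eq simp del: mem_ball_0 minus_diff_eq)
qed

lemma A_class_holomorphic: "f \<in> A_class \<alpha> \<Longrightarrow> f holomorphic_on ball 0 1"
  by (simp add: A_class_iff)

lemma A_class_cong:
  assumes "f \<in> A_class \<alpha>" "\<And>z. z \<in> ball 0 1 \<Longrightarrow> f z = g z"
  shows "g \<in> A_class \<alpha>"
proof -
  have f: "f holomorphic_on ball 0 1" by (rule A_class_holomorphic[OF assms(1)])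
  then have g: "g holomorphic_on ball 0 1"
    using holomorphic_cong[of "ball 0 1" "ball 0 1" f g] assms(2) by auto
  have "(deriv ^^ i) f z = (deriv ^^ i) g z" if "z \<in> ball 0 1" for i z
    using f g that assms(2) by (intro higher_deriv_transform_within_open[of f "ball 0 1"]) auto
  with assms(1) g show ?thesis unfolding A_class_iff by (blast intro: growth_cong)
qed

text \<open>
  Derivatives below the defining order need not be bounded: for integer \<open>\<alpha>\<close>
  the last one may grow logarithmically. An arbitrarily small power covers all cases at once: the
  top derivative has exponent at most 1, hence at most \<open>1 + \<epsilon>\<close>, and each
  integration returns \<open>\<epsilon>\<close>.
\<close>

lemma A_class_deriv_growth:
  assumes f: "f \<in> A_class \<alpha>" and "\<alpha> > 0" and "i < least_nat_above \<alpha>" and "\<epsilon> > 0"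
  shows "growth \<epsilon> ((deriv ^^ i) f)"
proof -
  define m where "m = least_nat_above \<alpha>"
  have hol: "(deriv ^^ k) f holomorphic_on ball 0 1" for k
    using A_class_holomorphic[OF f] by (intro holomorphic_higher_deriv) auto
  have m: "growth (real m - \<alpha>) ((deriv ^^ m) f)" "real m - \<alpha> \<le> 1"
    using f least_nat_above[of \<alpha>] \<open>\<alpha> > 0\<close> by (auto simp: A_class_iff m_def)
  have "growth (1 + \<epsilon>) ((deriv ^^ m) f)" if "\<epsilon> > 0" for \<epsilon>
    using m that by (intro growth_mono[OF m(1)]) auto
  note m' = this
  have top: "growth \<epsilon> ((deriv ^^ (m - 1)) f)" if "\<epsilon> > 0" for \<epsilon>
  proof (rule growth_of_deriv[OF hol _ that])
    have "deriv ((deriv ^^ (m - 1)) f) = (deriv ^^ Suc (m - 1)) f" by simp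
    also have "Suc (m - 1) = m" using least_nat_above(3)[of \<alpha>] \<open>\<alpha> > 0\<close> by (simp add: m_def)
    finally show "growth (1 + \<epsilon>) (deriv ((deriv ^^ (m - 1)) f))"
      using m'[OF that] by simp
  qed
  have "i \<le> m - 1" using assms(3) by (auto simp: m_def)
  then have "\<forall>\<epsilon>>0. growth \<epsilon> ((deriv ^^ i) f)"
  proof (induction i rule: inc_induct)
    case base
    show ?case using top by blast
  next
    case (step k)
    show ?case
    proof (intro allI impI)
      fix \<epsilon> :: real assume "\<epsilon> > 0"
      then have "growth (1 + \<epsilon>) ((deriv ^^ Suc k) f)"
        using step.IH by auto
      then show "growth \<epsilon> ((deriv ^^ k) f)"
        using growth_of_deriv[OF hol[of k], of \<epsilon>] \<open>\<epsilon> > 0\<close> by simp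
    qed
  qed
  with \<open>\<epsilon> > 0\<close> show ?thesis by blast
qed

lemma A_class_bounded:
  assumes f: "f \<in> A_class \<alpha>" and "\<alpha> > 0"
  shows "growth 0 f"
proof -
  have *: "f holomorphic_on ball 0 1" "growth (real (least_nat_above \<alpha>) - \<alpha>) ((deriv ^^ least_nat_above \<alpha>) f)"
    using f by (auto simp: A_class_iff)
  show ?thesis
  proof (cases "least_nat_above \<alpha> = 1")
    case True
    with * show ?thesis
      using \<open>\<alpha> > 0\<close> by (intro bounded_of_deriv_growth[of f "1 - \<alpha>"]) auto
  next
    case False
    then have "growth (1/2) ((deriv ^^ 1) f)"
      using least_nat_above[of \<alpha>] \<open>\<alpha> > 0\<close> by (intro A_class_deriv_growth[OF f]) auto
    with * show ?thesis by (intro bounded_of_deriv_growth[of f "1/2"]) auto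
  qed
qed

lemma A_class_mono:
  assumes f: "f \<in> A_class \<alpha>" and "0 < \<beta>" "\<beta> \<le> \<alpha>"
  shows "f \<in> A_class \<beta>"
proof (cases "least_nat_above \<beta> < least_nat_above \<alpha>")
  case True
  then have "growth (real (least_nat_above \<beta>) - \<beta>) ((deriv ^^ least_nat_above \<beta>) f)"
    using \<open>0 < \<beta>\<close> \<open>\<beta> \<le> \<alpha>\<close> least_nat_above(1)[of \<beta>] by (intro A_class_deriv_growth[OF f]) linarith+
  with A_class_holomorphic[OF f] show ?thesis unfolding A_class_iff by blast
next
  case False
  moreover have "least_nat_above \<beta> \<le> least_nat_above \<alpha>"
    using least_nat_above(1)[of \<alpha>] \<open>0 < \<beta>\<close> \<open>\<beta> \<le> \<alpha>\<close> unfolding least_nat_above_def[of \<beta>]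
    by (intro Least_le) linarith
  ultimately have "least_nat_above \<beta> = least_nat_above \<alpha>" by simp
  with f \<open>\<beta> \<le> \<alpha>\<close> show ?thesis
    unfolding A_class_iff by (metis growth_mono diff_left_mono)
qed

lemma A_class_deriv:
  assumes "f \<in> A_class (\<alpha> + 1)" "\<alpha> > 0"
  shows "deriv f \<in> A_class \<alpha>"
proof -
  have "deriv f holomorphic_on ball 0 1"
    using A_class_holomorphic[OF assms(1)] by (intro holomorphic_deriv) auto
  moreover have "growth (real (Suc (least_nat_above \<alpha>)) - (\<alpha> + 1)) ((deriv ^^ Suc (least_nat_above \<alpha>)) f)"
    using assms(1) least_nat_above_Suc[OF \<open>\<alpha> > 0\<close>] by (metis A_class_iff)
  moreover have "(deriv ^^ Suc (least_nat_above \<alpha>)) f = (deriv ^^ least_nat_above \<alpha>) (deriv f)"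
    by (simp only: funpow_Suc_right o_apply)
  moreover have "real (Suc (least_nat_above \<alpha>)) - (\<alpha> + 1) = real (least_nat_above \<alpha>) - \<alpha>" by simp
  ultimately show ?thesis unfolding A_class_iff by metis
qed

lemma A_class_higher_deriv:
  assumes "f \<in> A_class \<alpha>" "real k < \<alpha>"
  shows "(deriv ^^ k) f \<in> A_class (\<alpha> - real k)"
  using assms(2)
proof (induction k)
  case (Suc k)
  then have "(deriv ^^ k) f \<in> A_class ((\<alpha> - real (Suc k)) + 1)" by simp
  from A_class_deriv[OF this] Suc.prems show ?case by simp
qed (use assms in simp)

text \<open>
  In Leibniz' formula for the derivative of order \<open>m\<close> the two extreme terms are a
  bounded function times a top derivative. In every other term both factors are derivatives below
  the defining order, so each can be given half of the permitted exponent.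
\<close>

lemma A_class_mult:
  assumes f: "f \<in> A_class \<alpha>" and g: "g \<in> A_class \<alpha>" and "\<alpha> > 0"
  shows "(\<lambda>z. f z * g z) \<in> A_class \<alpha>"
proof -
  define m where "m = least_nat_above \<alpha>"
  define \<gamma> where "\<gamma> = real m - \<alpha>"
  have "\<gamma> > 0" "m > 0" using least_nat_above[of \<alpha>] \<open>\<alpha> > 0\<close> by (auto simp: m_def \<gamma>_def)
  have hol: "f holomorphic_on ball 0 1" "g holomorphic_on ball 0 1"
    using f g by (auto intro: A_class_holomorphic)
  have top: "growth \<gamma> ((deriv ^^ m) f)" "growth \<gamma> ((deriv ^^ m) g)"
    using f g unfolding A_class_iff m_def \<gamma>_def by blast+
  have summand: "growth \<gamma> (\<lambda>z. (deriv ^^ i) f z * (deriv ^^ (m - i)) g z)" if "i \<le> m" for i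
  proof -
    consider "i = 0" | "i = m" | "i < m" "0 < i" using \<open>i \<le> m\<close> by linarith
    then show ?thesis
    proof cases
      case 1
      then show ?thesis
        using growth_mult[OF A_class_bounded[OF f \<open>\<alpha> > 0\<close>] top(2)] by simp
    next
      case 2
      then show ?thesis
        using growth_mult[OF top(1) A_class_bounded[OF g \<open>\<alpha> > 0\<close>]] by simp
    next
      case 3
      then have "i < least_nat_above \<alpha>" "m - i < least_nat_above \<alpha>" unfolding m_def by linarith+
      then have "growth (\<gamma>/2) ((deriv ^^ i) f)" "growth (\<gamma>/2) ((deriv ^^ (m - i)) g)"
        using \<open>\<gamma> > 0\<close> A_class_deriv_growth[OF f \<open>\<alpha> > 0\<close>] A_class_deriv_growth[OF g \<open>\<alpha> > 0\<close>]
        by simp_all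
      from growth_mult[OF this] show ?thesis by simp
    qed
  qed
  have "growth \<gamma> (\<lambda>z. \<Sum>i = 0..m. of_nat (m choose i) * ((deriv ^^ i) f z * (deriv ^^ (m - i)) g z))"
  proof (rule growth_sum)
    fix i assume "i \<in> {0..m}"
    then have "growth (0 + \<gamma>) (\<lambda>z. of_nat (m choose i) * ((deriv ^^ i) f z * (deriv ^^ (m - i)) g z))"
      by (intro growth_mult[OF growth_const[of 0] summand]) auto
    then show "growth \<gamma> (\<lambda>z. of_nat (m choose i) * ((deriv ^^ i) f z * (deriv ^^ (m - i)) g z))"
      by simp
  qed auto
  then have "growth \<gamma> ((deriv ^^ m) (\<lambda>z. f z * g z))"
    by (rule growth_cong) (use hol in \<open>auto simp: higher_deriv_mult[of f "ball 0 1"] mult.assoc\<close>)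
  then show ?thesis
    using holomorphic_on_mult[OF hol] unfolding A_class_iff m_def \<gamma>_def by blast
qed

lemma A_class_add:
  assumes f: "f \<in> A_class \<alpha>" and g: "g \<in> A_class \<alpha>"
  shows "(\<lambda>z. f z + g z) \<in> A_class \<alpha>"
proof -
  have hol: "f holomorphic_on ball 0 1" "g holomorphic_on ball 0 1"
    using f g by (auto intro: A_class_holomorphic)
  have "growth (real (least_nat_above \<alpha>) - \<alpha>) ((deriv ^^ least_nat_above \<alpha>) (\<lambda>z. f z + g z))"
    by (rule growth_cong[OF growth_add])
       (use f g hol in \<open>auto simp: A_class_iff higher_deriv_add[of f "ball 0 1"]\<close>)
  with hol show ?thesis by (auto simp: A_class_iff intro: holomorphic_intros)
qed

lemma A_class_const:
  assumes "\<alpha> > 0"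
  shows "(\<lambda>z. a) \<in> A_class \<alpha>"
proof -
  have "growth (real (least_nat_above \<alpha>) - \<alpha>) ((deriv ^^ least_nat_above \<alpha>) (\<lambda>z. a))"
    using least_nat_above[of \<alpha>] assms unfolding higher_deriv_const by (intro growth_const) auto
  then show ?thesis by (auto simp: A_class_iff)
qed

lemma A_class_sum:
  assumes "\<alpha> > 0" "\<And>i. i \<in> I \<Longrightarrow> F i \<in> A_class \<alpha>"
  shows "(\<lambda>z. \<Sum>i\<in>I. F i z) \<in> A_class \<alpha>"
  using assms(2)
proof (induction I rule: infinite_finite_induct)
  case (insert i I)
  have "(\<lambda>z. F i z + (\<Sum>i\<in>I. F i z)) \<in> A_class \<alpha>"
    by (rule A_class_add; (rule insert.IH)?; rule insert.prems; simp)
  with insert.hyps show ?case by simp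
qed (simp_all add: A_class_const[OF assms(1)])

lemma A_class_prod:
  assumes "\<alpha> > 0" "\<And>i. i \<in> I \<Longrightarrow> F i \<in> A_class \<alpha>"
  shows "(\<lambda>z. \<Prod>i\<in>I. F i z) \<in> A_class \<alpha>"
  using assms(2)
proof (induction I rule: infinite_finite_induct)
  case (insert i I)
  have "(\<lambda>z. F i z * (\<Prod>i\<in>I. F i z)) \<in> A_class \<alpha>"
    by (rule A_class_mult[OF _ _ assms(1)]; (rule insert.IH)?; rule insert.prems; simp)
  with insert.hyps show ?case by simp
qed (simp_all add: A_class_const[OF assms(1)])

section \<open>Cauchy integrals and pairings on the unit circle\<close>

definition circle_integral :: "(complex \<Rightarrow> complex) \<Rightarrow> complex" where
  "circle_integral u = integral {0..2 * pi} (\<lambda>t. u (cis t))"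

lemma circle_integral_cnj: "circle_integral (\<lambda>\<zeta>. cnj (u \<zeta>)) = cnj (circle_integral u)"
  by (simp add: circle_integral_def integral_cnj)

lemma circle_integral_cmult: "circle_integral (\<lambda>\<zeta>. c * u \<zeta>) = c * circle_integral u"
  by (simp add: circle_integral_def)

lemma circle_integral_cong:
  assumes "\<And>\<zeta>. norm \<zeta> = 1 \<Longrightarrow> u \<zeta> = v \<zeta>"
  shows "circle_integral u = circle_integral v"
  using assms by (simp add: circle_integral_def)

lemma continuous_on_circle:
  fixes u :: "complex \<Rightarrow> complex"
  assumes "continuous_on (sphere 0 1) u"
  shows "continuous_on S (\<lambda>t. u (cis t))"
  by (rule continuous_on_compose2[OF assms]) (auto intro!: continuous_intros)

lemma circle_integrable:
  fixes u :: "complex \<Rightarrow> complex"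
  assumes "continuous_on (sphere 0 1) u"
  shows "(\<lambda>t. u (cis t)) integrable_on {0..2 * pi}"
  using continuous_on_circle[OF assms] by (rule integrable_continuous_real)

lemma Cauchy_circle:
  fixes u :: "complex \<Rightarrow> complex"
  assumes u: "continuous_on (cball 0 1) u" "u holomorphic_on ball 0 1" and z: "z \<in> ball 0 1"
  shows "circle_integral (\<lambda>\<zeta>. u \<zeta> * cnj \<zeta> ^ k / (1 - cnj \<zeta> * z) ^ Suc k) =
    2 * pi / fact k * (deriv ^^ k) u z"
proof -
  have "((\<lambda>\<zeta>. u \<zeta> / (\<zeta> - z) ^ Suc k) has_contour_integral
      2 * pi * \<i> / fact k * (deriv ^^ k) u z) (circlepath 0 1)"
    by (rule Cauchy_has_contour_integral_higher_derivative_circlepath[OF u z])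
  then have "((\<lambda>t. u (cis t) / (cis t - z) ^ Suc k * \<i> * cis t) has_integral
      2 * pi * \<i> / fact k * (deriv ^^ k) u z) {0..2 * pi}"
    unfolding circlepath_def by (subst (asm) has_contour_integral_part_circlepath_iff) auto
  from has_integral_mult_right[OF this, of "- \<i>"]
  have "((\<lambda>t. u (cis t) * cis t / (cis t - z) ^ Suc k) has_integral
      2 * pi / fact k * (deriv ^^ k) u z) {0..2 * pi}"
    by (simp add: mult_ac)
  moreover have "\<zeta> / (\<zeta> - z) ^ Suc k = cnj \<zeta> ^ k / (1 - cnj \<zeta> * z) ^ Suc k"
    if "norm \<zeta> = 1" for \<zeta>
  proof -
    have inv: "\<zeta> * cnj \<zeta> = 1" "\<zeta> \<noteq> 0"
      using that complex_norm_square[of \<zeta>] by auto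
    have "\<zeta> - z = \<zeta> * (1 - cnj \<zeta> * z)"
      by (simp only: right_diff_distrib mult.assoc[symmetric] inv(1)) simp
    then have "\<zeta> / (\<zeta> - z) ^ Suc k = \<zeta> / (\<zeta> ^ Suc k * (1 - cnj \<zeta> * z) ^ Suc k)"
      by (metis power_mult_distrib)
    also have "\<dots> = (\<zeta> / \<zeta> ^ Suc k) / (1 - cnj \<zeta> * z) ^ Suc k"
      by simp
    also have "\<zeta> / \<zeta> ^ Suc k = inverse \<zeta> ^ k"
      using inv(2) by (simp add: field_simps)
    also have "inverse \<zeta> = cnj \<zeta>"
      using inv by (metis inverse_unique)
    finally show ?thesis .
  qed
  ultimately have "((\<lambda>t. u (cis t) * (cnj (cis t) ^ k / (1 - cnj (cis t) * z) ^ Suc k)) has_integral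
      2 * pi / fact k * (deriv ^^ k) u z) {0..2 * pi}"
    by (simp only: times_divide_eq_right[symmetric] norm_cis)
  then show ?thesis
    unfolding circle_integral_def by (simp add: integral_unique)
qed

lemma circle_mean_value:
  fixes u :: "complex \<Rightarrow> complex"
  assumes "continuous_on (cball 0 1) u" "u holomorphic_on ball 0 1"
  shows "circle_integral u = 2 * pi * u 0"
  using Cauchy_circle[OF assms, of 0 0] by simp

lemma Cauchy_formula_circle:
  fixes u :: "complex \<Rightarrow> complex"
  assumes "continuous_on (cball 0 1) u" "u holomorphic_on ball 0 1" "z \<in> ball 0 1"
  shows "circle_integral (\<lambda>\<zeta>. u \<zeta> / (1 - cnj \<zeta> * z)) = 2 * pi * u z"
  using Cauchy_circle[OF assms, of 0] by simp

lemma one_minus_mult_nonzero: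
  fixes a b :: complex
  assumes "norm a \<le> 1" "norm b < 1"
  shows "1 - a * b \<noteq> 0"
proof
  assume "1 - a * b = 0"
  then have "norm (a * b) = 1" by simp
  moreover have "norm (a * b) \<le> 1 * norm b" 
    unfolding norm_mult using assms by (intro mult_right_mono) auto
  ultimately show False using assms by simp
qed

lemma dilated_on_disc:
  fixes u :: "complex \<Rightarrow> complex"
  assumes u: "continuous_on (cball 0 1) u" "u holomorphic_on ball 0 1" and s: "0 \<le> s" "s \<le> 1"
  shows "continuous_on (cball 0 1) (\<lambda>w. u (of_real s * w))" 
    and "(\<lambda>w. u (of_real s * w)) holomorphic_on ball 0 1"
proof -
  have le: "norm (of_real s * w) \<le> norm w" for w :: complex
    using s by (simp add: norm_mult mult_left_le_one_le)
  have c: "of_real s * w \<in> cball 0 1" if "w \<in> cball 0 1" for w :: complex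
    using le[of w] that by (simp add: norm_mult)
  have b: "of_real s * w \<in> ball 0 1" if "w \<in> ball 0 1" for w :: complex
    using le[of w] that by (simp add: norm_mult)
  show "continuous_on (cball 0 1) (\<lambda>w. u (of_real s * w))"
    by (rule continuous_on_compose2[OF u(1)]) (use c in \<open>auto intro!: continuous_intros simp del: mem_cball_0\<close>)
  show "(\<lambda>w. u (of_real s * w)) holomorphic_on ball 0 1"
    using holomorphic_on_compose_gen[of "\<lambda>w. of_real s * w" "ball 0 1" u "ball 0 1"] u(2) b
    by (auto simp: o_def image_subset_iff intro!: holomorphic_intros simp del: mem_ball_0)
qed

text \<open>
  Both sides are \<open>2 * pi\<close> times the sum of \<open>u\<^sub>n * cnj v\<^sub>n * r ^
  n\<close> over the Taylor coefficients, so only the product of the two radii matters. The proof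
  avoids power series: it expresses \<open>u (r * \<zeta>)\<close> by Cauchy's formula on the
  circle of radius \<open>sqrt r\<close>, exchanges the integrals, and applies Cauchy's formula to
  \<open>v\<close>.
\<close>

lemma circle_pairing_dilate:
  fixes u v :: "complex \<Rightarrow> complex"
  assumes u: "continuous_on (cball 0 1) u" "u holomorphic_on ball 0 1"
    and v: "continuous_on (cball 0 1) v" "v holomorphic_on ball 0 1" 
    and r: "0 \<le> r" "r < 1"
  shows "circle_integral (\<lambda>\<zeta>. u (of_real r * \<zeta>) * cnj (v \<zeta>)) =
    circle_integral (\<lambda>\<zeta>. u (of_real (sqrt r) * \<zeta>) * cnj (v (of_real (sqrt r) * \<zeta>)))"
proof -
  define s where "s = sqrt r"
  have s: "0 \<le> s" "s < 1" "s * s = r" using r by (auto simp: s_def real_sqrt_lt_1_iff)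
  have sball: "of_real s * \<zeta> \<in> ball 0 1" if "norm \<zeta> = 1" for \<zeta> :: complex
    using that s by (simp add: norm_mult)
  \<comment> \<open>Integrating over \<open>\<tau>\<close> reproduces \<open>u\<close>, integrating over
    \<open>t\<close> reproduces \<open>v\<close>; the factor \<open>s\<close> keeps the points at
    which they are reproduced inside the disc.\<close>
  define G where "G t \<tau> = u (of_real s * cis \<tau>) * cnj (v (cis t)) / (1 - cnj (cis \<tau>) * (of_real s * cis t))" for t \<tau>
  have us: "continuous_on (cball 0 1) (\<lambda>w. u (of_real s * w))" "(\<lambda>w. u (of_real s * w)) holomorphic_on ball 0 1"
    using dilated_on_disc[OF u] s by auto
  have cont: "continuous_on (cbox (0, 0) (2 * pi, 2 * pi)) (\<lambda>(t, \<tau>). G t \<tau>)"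
    unfolding G_def case_prod_unfold
  proof (intro continuous_intros ballI)
    show "continuous_on (cbox (0, 0) (2 * pi, 2 * pi)) (\<lambda>x :: real \<times> real. u (of_real s * cis (snd x)))"
      by (rule continuous_on_compose2[OF u(1)]) (use s in \<open>auto intro!: continuous_intros simp: norm_mult\<close>)
    show "continuous_on (cbox (0, 0) (2 * pi, 2 * pi)) (\<lambda>x :: real \<times> real. v (cis (fst x)))"
      by (rule continuous_on_compose2[OF v(1)]) (auto intro!: continuous_intros)
    fix x :: "real \<times> real"
    show "1 - cnj (cis (snd x)) * (of_real s * cis (fst x)) \<noteq> 0"
      using s by (intro one_minus_mult_nonzero) (auto simp: norm_mult)
  qed
  have inner1: "integral {0..2 * pi} (G t) = 2 * pi * (u (of_real r * cis t) * cnj (v (cis t)))" for t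
  proof -
    have "integral {0..2 * pi} (G t) =
        circle_integral (\<lambda>\<zeta>. cnj (v (cis t)) * (u (of_real s * \<zeta>) / (1 - cnj \<zeta> * (of_real s * cis t))))"
      unfolding circle_integral_def G_def by (simp add: mult_ac)
    also have "\<dots> = cnj (v (cis t)) * (2 * pi * u (of_real s * (of_real s * cis t)))"
      unfolding circle_integral_cmult using Cauchy_formula_circle[OF us sball, of "cis t"] by simp
    also have "of_real s * (of_real s * cis t) = of_real r * cis t"
      unfolding s(3)[symmetric] by simp
    finally show ?thesis by (simp add: mult_ac)
  qed
  have inner2: "integral {0..2 * pi} (\<lambda>t. G t \<tau>) = 2 * pi * (u (of_real s * cis \<tau>) * cnj (v (of_real s * cis \<tau>)))" for \<tau>
  proof -
    have "integral {0..2 * pi} (\<lambda>t. G t \<tau>) =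
        circle_integral (\<lambda>\<zeta>. u (of_real s * cis \<tau>) * cnj (v \<zeta> / (1 - cnj \<zeta> * (of_real s * cis \<tau>))))"
      unfolding circle_integral_def G_def by (simp add: mult_ac)
    also have "\<dots> = u (of_real s * cis \<tau>) * cnj (2 * pi * v (of_real s * cis \<tau>))"
      unfolding circle_integral_cmult circle_integral_cnj
      using Cauchy_formula_circle[OF v sball, of "cis \<tau>"] by simp
    finally show ?thesis by simp
  qed
  have "2 * pi * circle_integral (\<lambda>\<zeta>. u (of_real r * \<zeta>) * cnj (v \<zeta>)) =
      integral (cbox 0 (2 * pi)) (\<lambda>t. integral (cbox 0 (2 * pi)) (G t))"
    unfolding circle_integral_def by (simp add: inner1)
  also have "\<dots> = integral (cbox 0 (2 * pi)) (\<lambda>\<tau>. integral (cbox 0 (2 * pi)) (\<lambda>t. G t \<tau>))"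
    by (rule integral_swap_continuous[OF cont])
  also have "\<dots> = 2 * pi * circle_integral (\<lambda>\<zeta>. u (of_real s * \<zeta>) * cnj (v (of_real s * \<zeta>)))"
    unfolding circle_integral_def by (simp add: inner2)
  finally show ?thesis by (simp add: s_def)
qed

text \<open>
  Cauchy's formula for \<open>1 / (1 - a * w)\<close> at the point \<open>cnj a\<close>: the
  conjugate factor of the squared norm is the Cauchy kernel of that point.
\<close>

lemma Poisson_integral_one:
  fixes a :: complex
  assumes "norm a < 1"
  shows "integral {0..2 * pi} (\<lambda>t. 1 / norm (1 - a * cis t) ^ 2) = 2 * pi / (1 - norm a ^ 2)"
proof -
  have nz: "1 - a * w \<noteq> 0" if "w \<in> cball 0 1" for w
    using one_minus_mult_nonzero[of w a] that assms by (simp add: mult.commute)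
  have "of_real (integral {0..2 * pi} (\<lambda>t. 1 / norm (1 - a * cis t) ^ 2)) =
      integral {0..2 * pi} (\<lambda>t. complex_of_real (1 / norm (1 - a * cis t) ^ 2))"
    by (intro integral_unique[symmetric] has_integral_of_real integrable_integral
          integrable_continuous_real continuous_intros) (use nz in auto)
  also have "\<dots> = circle_integral (\<lambda>\<zeta>. 1 / (1 - a * \<zeta>) / (1 - cnj \<zeta> * cnj a))"
  proof -
    have "complex_of_real (1 / norm (1 - a * \<zeta>) ^ 2) = 1 / (1 - a * \<zeta>) / (1 - cnj \<zeta> * cnj a)" for \<zeta>
      using complex_norm_square[of "1 - a * \<zeta>"] by (simp add: mult_ac)
    then show ?thesis unfolding circle_integral_def by simp
  qed
  also have "\<dots> = 2 * pi * (1 / (1 - a * cnj a))"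
    using nz assms by (intro Cauchy_formula_circle) (auto intro!: continuous_intros holomorphic_intros)
  also have "\<dots> = of_real (2 * pi / (1 - norm a ^ 2))"
    using complex_norm_square[of a] by simp
  finally show ?thesis unfolding of_real_eq_iff .
qed

text \<open>
  Two of the \<open>m + 1\<close> factors are integrated exactly; the others are bounded by
  \<open>1 / (1 - norm a)\<close>. This loses only a constant compared to the true size of the
  integral.
\<close>

lemma circle_kernel_bound:
  fixes a :: complex
  assumes a: "norm a < 1" and m: "m > 0"
  shows "integral {0..2 * pi} (\<lambda>t. 1 / norm (1 - a * cis t) ^ Suc m) \<le> 2 * pi / (1 - norm a) ^ m"
proof -
  have nz: "1 - a * cis t \<noteq> 0" for t
    using one_minus_mult_nonzero[of "cis t" a] a by (simp add: mult.commute)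
  have le: "1 / norm (1 - a * cis t) ^ Suc m \<le> 1 / (1 - norm a) ^ (m - 1) * (1 / norm (1 - a * cis t) ^ 2)" for t
  proof -
    have "1 - norm a \<le> norm (1 - a * cis t)"
      using norm_triangle_ineq2[of 1 "a * cis t"] by (simp add: norm_mult)
    then have "(1 - norm a) ^ (m - 1) * norm (1 - a * cis t) ^ 2 \<le> norm (1 - a * cis t) ^ (m - 1) * norm (1 - a * cis t) ^ 2"
      using a by (intro mult_right_mono power_mono) auto
    also have "\<dots> = norm (1 - a * cis t) ^ Suc m"
      using m by (simp flip: power_add)
    finally have "1 / norm (1 - a * cis t) ^ Suc m \<le> 1 / ((1 - norm a) ^ (m - 1) * norm (1 - a * cis t) ^ 2)"
      using a nz[of t] by (intro divide_left_mono mult_pos_pos) auto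
    then show ?thesis by simp
  qed
  have "integral {0..2 * pi} (\<lambda>t. 1 / norm (1 - a * cis t) ^ Suc m) \<le>
      integral {0..2 * pi} (\<lambda>t. 1 / (1 - norm a) ^ (m - 1) * (1 / norm (1 - a * cis t) ^ 2))"
    using nz by (intro integral_le le integrable_continuous_real continuous_intros) auto
  also have "\<dots> = 1 / (1 - norm a) ^ (m - 1) * (2 * pi / (1 - norm a ^ 2))"
    unfolding integral_mult_right Poisson_integral_one[OF a] ..
  also have "\<dots> \<le> 1 / (1 - norm a) ^ (m - 1) * (2 * pi / (1 - norm a))"
  proof (intro mult_left_mono divide_left_mono mult_pos_pos)
    have "norm a ^ 2 \<le> norm a" using a by (simp add: power2_eq_square mult_left_le_one_le)
    then show "1 - norm a \<le> 1 - norm a ^ 2" by simp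
    show "1 - (norm a)\<^sup>2 > 0" using \<open>norm a ^ 2 \<le> norm a\<close> a by simp
  qed (use a in auto)
  also have "\<dots> = 2 * pi / ((1 - norm a) ^ (m - 1) * (1 - norm a))" by simp
  also have "(1 - norm a) ^ (m - 1) * (1 - norm a) = (1 - norm a) ^ m"
    using m by (metis power_minus_mult)
  finally show ?thesis .
qed

lemma holomorphic_larger_disc:
  assumes "h holomorphic_on ball 0 \<rho>" "\<rho> > 1"
  shows "continuous_on (cball 0 1) h" "h holomorphic_on ball 0 1"
proof -
  have "cball 0 1 \<subseteq> ball 0 \<rho>" "ball 0 1 \<subseteq> ball 0 \<rho>" using assms(2) by auto
  then show "continuous_on (cball 0 1) h" "h holomorphic_on ball 0 1"
    using assms(1) by (meson holomorphic_on_imp_continuous_on holomorphic_on_subset)+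
qed

text \<open>
  Taylor's formula at 0 along the radius to \<open>\<zeta>\<close>, with integral remainder. The
  factor \<open>\<zeta> ^ m\<close> of the remainder cancels against \<open>cnj \<zeta> ^
  m\<close>. The polynomial part has degree below \<open>m\<close> and is orthogonal to
  \<open>\<zeta> ^ m * \<kappa> \<zeta>\<close>, which vanishes at 0 to order \<open>m\<close>.
\<close>

lemma circle_pairing_radial_Taylor:
  fixes h \<kappa> :: "complex \<Rightarrow> complex"
  assumes h: "h holomorphic_on ball 0 \<rho>" "\<rho> > 1"
    and \<kappa>: "continuous_on (cball 0 1) \<kappa>" "\<kappa> holomorphic_on ball 0 1" 
    and m: "m > 0"
  shows "circle_integral (\<lambda>\<zeta>. h \<zeta> * cnj (\<zeta> ^ m * \<kappa> \<zeta>)) =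
    integral {0..1} (\<lambda>r. of_real ((1 - r) ^ (m - 1) / fact (m - 1)) *
      circle_integral (\<lambda>\<zeta>. (deriv ^^ m) h (of_real r * \<zeta>) * cnj (\<kappa> \<zeta>)))"
proof -
  define D where "D i = (deriv ^^ i) h" for i
  have D: "D i holomorphic_on ball 0 \<rho>" for i
    using h unfolding D_def by (intro holomorphic_higher_deriv) auto
  define k where "k \<zeta> = cnj (\<zeta> ^ m * \<kappa> \<zeta>)" for \<zeta>
  have contk: "continuous_on (sphere 0 1) k"
    unfolding k_def using \<kappa>(1) by (intro continuous_intros) (auto intro: continuous_on_subset)
  have conth: "continuous_on (sphere 0 1) h"
    using holomorphic_larger_disc(1)[OF h] by (rule continuous_on_subset) auto
  define T where "T \<zeta> = (\<Sum>i<m. D i 0 / fact i * (\<zeta> ^ i * k \<zeta>))" for \<zeta>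
  have zero: "circle_integral (\<lambda>\<zeta>. \<zeta> ^ i * k \<zeta>) = 0" if "i < m" for i
  proof -
    have "circle_integral (\<lambda>\<zeta>. \<zeta> ^ i * k \<zeta>) = circle_integral (\<lambda>\<zeta>. cnj (\<zeta> ^ (m - i) * \<kappa> \<zeta>))"
    proof (rule circle_integral_cong)
      fix \<zeta> :: complex assume "norm \<zeta> = 1"
      then have "\<zeta> * cnj \<zeta> = 1" using complex_norm_square[of \<zeta>] by simp
      then have "\<zeta> ^ i * cnj \<zeta> ^ i = 1" by (metis power_mult_distrib power_one)
      moreover have "cnj \<zeta> ^ m = cnj \<zeta> ^ i * cnj \<zeta> ^ (m - i)"
        using that by (simp flip: power_add)
      ultimately show "\<zeta> ^ i * k \<zeta> = cnj (\<zeta> ^ (m - i) * \<kappa> \<zeta>)"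
        by (simp add: k_def mult.assoc[symmetric])
    qed
    also have "\<dots> = cnj (2 * pi * (0 ^ (m - i) * \<kappa> 0))"
      unfolding circle_integral_cnj using \<kappa>
      by (subst circle_mean_value) (auto intro!: continuous_intros holomorphic_intros)
    finally show ?thesis using that by simp
  qed
  have T0: "((\<lambda>t. T (cis t)) has_integral 0) {0..2 * pi}"
  proof -
    have "((\<lambda>t. D i 0 / fact i * (cis t ^ i * k (cis t))) has_integral D i 0 / fact i * 0) {0..2 * pi}"
      if "i < m" for i
    proof (rule has_integral_mult_right)
      have "((\<lambda>t. cis t ^ i * k (cis t)) has_integral circle_integral (\<lambda>\<zeta>. \<zeta> ^ i * k \<zeta>)) {0..2 * pi}"
        unfolding circle_integral_def using contk
        by (intro integrable_integral circle_integrable[of "\<lambda>\<zeta>. \<zeta> ^ i * k \<zeta>"] continuous_intros)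
      then show "((\<lambda>t. cis t ^ i * k (cis t)) has_integral 0) {0..2 * pi}"
        using zero[OF that] by simp
    qed
    then have "((\<lambda>t. T (cis t)) has_integral (\<Sum>i<m. D i 0 / fact i * 0)) {0..2 * pi}"
      unfolding T_def by (intro has_integral_sum) auto
    then show ?thesis by simp
  qed
  define G where "G t r = of_real ((1 - r) ^ (m - 1) / fact (m - 1)) * (D m (of_real r * cis t) * cnj (\<kappa> (cis t)))"
    for t r :: real
  have rest: "h (cis t) * k (cis t) - T (cis t) = integral {0..1} (G t)" for t
  proof -
    define \<zeta> where "\<zeta> = cis t"
    have nz: "norm \<zeta> = 1" by (simp add: \<zeta>_def)
    then have inv: "\<zeta> ^ m * cnj \<zeta> ^ m = 1"
      using complex_norm_square[of \<zeta>] by (metis of_real_1 power_mult_distrib power_one)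
    have rin: "of_real r * \<zeta> \<in> ball 0 \<rho>" if "r \<in> {0..1}" for r
      using that nz h(2) by (auto simp: norm_mult)
    have "h (of_real 1 * \<zeta>) = (\<Sum>i<m. ((1 - 0) ^ i / fact i) *\<^sub>R (D i (of_real 0 * \<zeta>) * \<zeta> ^ i)) +
      integral {0..1} (\<lambda>r. ((1 - r) ^ (m - 1) / fact (m - 1)) *\<^sub>R (D m (of_real r * \<zeta>) * \<zeta> ^ m))"
    proof (rule Taylor_integral[where Df = "\<lambda>i r. D i (of_real r * \<zeta>) * \<zeta> ^ i" and f = "\<lambda>r. h (of_real r * \<zeta>)"])
      fix i and r :: real assume r: "0 \<le> r" "r \<le> 1"
      have "(D i has_field_derivative D (Suc i) (of_real r * \<zeta>)) (at (of_real r * \<zeta>))"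
        using D[of i] rin[of r] r unfolding D_def
        by (auto intro!: holomorphic_derivI[of _ "ball 0 \<rho>"] simp del: mem_ball_0)
      moreover have "((\<lambda>r. of_real r * \<zeta>) has_vector_derivative \<zeta>) (at r)"
        by (auto intro!: derivative_eq_intros)
      ultimately have "((\<lambda>r. D i (of_real r * \<zeta>)) has_vector_derivative \<zeta> * D (Suc i) (of_real r * \<zeta>)) (at r)"
        using field_vector_diff_chain_at[of "\<lambda>r. of_real r * \<zeta>" \<zeta> r "D i"] by (simp add: o_def)
      then have "((\<lambda>r. D i (of_real r * \<zeta>) * \<zeta> ^ i) has_vector_derivative 
          (\<zeta> * D (Suc i) (of_real r * \<zeta>)) * \<zeta> ^ i) (at r)"
        by (rule has_vector_derivative_mult_left)
      then show "((\<lambda>r. D i (of_real r * \<zeta>) * \<zeta> ^ i) has_vector_derivative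
          D (Suc i) (of_real r * \<zeta>) * \<zeta> ^ Suc i) (at r within {0..1})"
        by (simp add: mult_ac has_vector_derivative_at_within)
    qed (use m in \<open>auto simp: D_def\<close>)
    moreover have "T \<zeta> = k \<zeta> * (\<Sum>i<m. ((1 - 0) ^ i / fact i) *\<^sub>R (D i (of_real 0 * \<zeta>) * \<zeta> ^ i))"
      by (simp add: T_def sum_distrib_left scaleR_conv_of_real mult_ac)
    ultimately have "h \<zeta> * k \<zeta> = T \<zeta> +
        k \<zeta> * integral {0..1} (\<lambda>r. ((1 - r) ^ (m - 1) / fact (m - 1)) *\<^sub>R (D m (of_real r * \<zeta>) * \<zeta> ^ m))"
      by (simp only: of_real_1 mult_1 mult.commute[of _ "k \<zeta>"] distrib_left)
    also have "k \<zeta> * integral {0..1} (\<lambda>r. ((1 - r) ^ (m - 1) / fact (m - 1)) *\<^sub>R (D m (of_real r * \<zeta>) * \<zeta> ^ m))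
        = integral {0..1} (G t)"
      unfolding integral_mult_right[symmetric]
    proof (rule integral_cong)
      fix r :: real
      show "k \<zeta> * ((1 - r) ^ (m - 1) / fact (m - 1)) *\<^sub>R (D m (of_real r * \<zeta>) * \<zeta> ^ m) = G t r"
        using inv unfolding k_def G_def \<zeta>_def[symmetric] scaleR_conv_of_real
        by (simp add: mult_ac)
    qed
    finally show ?thesis by (simp add: \<zeta>_def)
  qed
  have cont: "continuous_on (cbox (0, 0) (2 * pi, 1)) (\<lambda>(t, r). G t r)"
    unfolding G_def case_prod_unfold
  proof (intro continuous_intros)
    show "continuous_on (cbox (0, 0) (2 * pi, 1)) (\<lambda>x :: real \<times> real. D m (of_real (snd x) * cis (fst x)))"
      using h(2) by (intro continuous_on_compose2[OF holomorphic_on_imp_continuous_on[OF D]])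
        (auto intro!: continuous_intros simp: norm_mult cbox_Pair_eq)
    show "continuous_on (cbox (0, 0) (2 * pi, 1)) (\<lambda>x :: real \<times> real. \<kappa> (cis (fst x)))"
      by (rule continuous_on_compose2[OF \<kappa>(1)]) (auto intro!: continuous_intros)
  qed auto
  have "((\<lambda>t. h (cis t) * k (cis t)) has_integral circle_integral (\<lambda>\<zeta>. h \<zeta> * k \<zeta>)) {0..2 * pi}"
    unfolding circle_integral_def using contk conth
    by (intro integrable_integral circle_integrable[of "\<lambda>\<zeta>. h \<zeta> * k \<zeta>"] continuous_intros)
  from has_integral_diff[OF this T0]
  have "circle_integral (\<lambda>\<zeta>. h \<zeta> * k \<zeta>) = integral (cbox 0 (2 * pi)) (\<lambda>t. integral (cbox 0 1) (G t))"
    by (simp add: rest integral_unique)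
  also have "\<dots> = integral (cbox 0 1) (\<lambda>r. integral (cbox 0 (2 * pi)) (\<lambda>t. G t r))"
    by (rule integral_swap_continuous[OF cont])
  also have "\<dots> = integral {0..1} (\<lambda>r. of_real ((1 - r) ^ (m - 1) / fact (m - 1)) *
      circle_integral (\<lambda>\<zeta>. D m (of_real r * \<zeta>) * cnj (\<kappa> \<zeta>)))"
    unfolding circle_integral_def G_def by (simp only: integral_mult_right cbox_interval)
  finally show ?thesis by (simp add: k_def D_def)
qed

section \<open>The growth of a pairing with a Cauchy kernel\<close>

text \<open>
  Only bounds in the open interval are needed, so \<open>\<phi>'\<close> may be singular at the
  endpoints as long as its primitive is continuous there.
\<close>

lemma norm_integral_le_primitive:
  fixes f :: "real \<Rightarrow> complex"
  assumes "a \<le> b" and f: "continuous_on {a..b} f" and \<phi>: "continuous_on {a..b} \<phi>"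
    and d\<phi>: "\<And>x. a < x \<Longrightarrow> x < b \<Longrightarrow> (\<phi> has_real_derivative \<phi>' x) (at x)"
    and le: "\<And>x. a < x \<Longrightarrow> x < b \<Longrightarrow> norm (f x) \<le> \<phi>' x"
  shows "norm (integral {a..b} f) \<le> \<phi> b - \<phi> a"
proof (cases "a < b")
  case True
  have "norm (integral {a..b} f - integral {a..a} f) \<le> \<phi> b - \<phi> a"
  proof (rule differentiable_bound_general[where f = "\<lambda>x. integral {a..x} f", OF True _ \<phi> _ _ le])
    show "continuous_on {a..b} (\<lambda>x. integral {a..x} f)"
      using f by (intro indefinite_integral_continuous_1 integrable_continuous_real)
    fix x assume x: "a < x" "x < b"
    show "((\<lambda>x. integral {a..x} f) has_vector_derivative f x) (at x)"
      using integral_has_vector_derivative[OF f, of x] x by (simp add: at_within_Icc_at)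
    show "(\<phi> has_vector_derivative \<phi>' x) (at x)"
      using d\<phi>[OF x] by (simp add: has_real_derivative_iff_has_vector_derivative)
  qed
  then show ?thesis by simp
qed (use \<open>a \<le> b\<close> in simp)

text \<open>
  The first bound is integrated over \<open>{1 - \<delta>..1}\<close>, where \<open>\<beta> >
  0\<close> makes it integrable; the second over \<open>{0..1 - \<delta>}\<close>, where
  \<open>\<beta> < \<mu>\<close> makes the contribution of the end \<open>1 - \<delta>\<close>
  dominate.
\<close>

lemma weighted_integral_bound:
  fixes f :: "real \<Rightarrow> complex"
  assumes f: "continuous_on {0..1} f" and \<delta>: "0 < \<delta>" "\<delta> \<le> 1" and \<beta>: "0 < \<beta>" "\<beta> < \<mu>" and "K \<ge> 0"
    and le1: "\<And>r. 0 < r \<Longrightarrow> r < 1 \<Longrightarrow> norm (f r) \<le> K * ((1 - r) powr (\<beta> - 1) * \<delta> powr (- \<mu>))"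
    and le2: "\<And>r. 0 < r \<Longrightarrow> r < 1 \<Longrightarrow> norm (f r) \<le> K * ((1 - r) powr (\<beta> - 1) * (1 - r) powr (- \<mu>))"
  shows "norm (integral {0..1} f) \<le> K * (1 / \<beta> + 1 / (\<mu> - \<beta>)) * \<delta> powr (\<beta> - \<mu>)"
proof -
  have f01: "continuous_on {0..1 - \<delta>} f" "continuous_on {1 - \<delta>..1} f"
    using f \<delta> by (auto elim!: continuous_on_subset)
  have "norm (integral {0..1 - \<delta>} f) \<le> K / (\<mu> - \<beta>) * (1 - (1 - \<delta>)) powr (\<beta> - \<mu>) - K / (\<mu> - \<beta>) * (1 - 0) powr (\<beta> - \<mu>)"
  proof (rule norm_integral_le_primitive[OF _ f01(1), where \<phi> = "\<lambda>r. K / (\<mu> - \<beta>) * (1 - r) powr (\<beta> - \<mu>)"])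
    show "continuous_on {0..1 - \<delta>} (\<lambda>r. K / (\<mu> - \<beta>) * (1 - r) powr (\<beta> - \<mu>))"
      using \<delta> by (intro continuous_intros) auto
    fix r assume r: "0 < r" "r < 1 - \<delta>"
    show "((\<lambda>r. K / (\<mu> - \<beta>) * (1 - r) powr (\<beta> - \<mu>)) has_real_derivative
        K / (\<mu> - \<beta>) * ((\<beta> - \<mu>) * (1 - r) powr (\<beta> - \<mu> - 1) * (- 1))) (at r)"
      using r \<delta> \<beta> by (auto intro!: derivative_eq_intros)
    have eq: "K / (\<mu> - \<beta>) * ((\<beta> - \<mu>) * y * (- 1)) = K * y" for y
      using \<beta> by (simp add: divide_simps) (simp add: algebra_simps)
    have "(1 - r) powr (\<beta> - \<mu> - 1) = (1 - r) powr (\<beta> - 1) * (1 - r) powr (- \<mu>)"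
      unfolding powr_add[symmetric] by (simp add: algebra_simps)
    then show "norm (f r) \<le> K / (\<mu> - \<beta>) * ((\<beta> - \<mu>) * (1 - r) powr (\<beta> - \<mu> - 1) * (- 1))"
      unfolding eq using r \<delta> le2[of r] by simp
  qed (use \<delta> in auto)
  also have "\<dots> \<le> K / (\<mu> - \<beta>) * \<delta> powr (\<beta> - \<mu>)"
    using \<open>K \<ge> 0\<close> \<beta> by (simp add: divide_nonneg_pos)
  finally have left: "norm (integral {0..1 - \<delta>} f) \<le> K / (\<mu> - \<beta>) * \<delta> powr (\<beta> - \<mu>)" .
  have "norm (integral {1 - \<delta>..1} f) \<le>
      - (K * \<delta> powr (- \<mu>) / \<beta> * (1 - 1) powr \<beta>) - - (K * \<delta> powr (- \<mu>) / \<beta> * (1 - (1 - \<delta>)) powr \<beta>)"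
  proof (rule norm_integral_le_primitive[OF _ f01(2), where \<phi> = "\<lambda>r. - (K * \<delta> powr (- \<mu>) / \<beta> * (1 - r) powr \<beta>)"])
    show "continuous_on {1 - \<delta>..1} (\<lambda>r. - (K * \<delta> powr (- \<mu>) / \<beta> * (1 - r) powr \<beta>))"
      using \<beta> by (intro continuous_intros continuous_on_powr') auto
    fix r assume r: "1 - \<delta> < r" "r < 1"
    show "((\<lambda>r. - (K * \<delta> powr (- \<mu>) / \<beta> * (1 - r) powr \<beta>)) has_real_derivative
        - (K * \<delta> powr (- \<mu>) / \<beta> * (\<beta> * (1 - r) powr (\<beta> - 1) * (- 1)))) (at r)"
      using r by (auto intro!: derivative_eq_intros)
    show "norm (f r) \<le> - (K * \<delta> powr (- \<mu>) / \<beta> * (\<beta> * (1 - r) powr (\<beta> - 1) * (- 1)))"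
      using le1[of r] r \<delta> \<beta> by (simp add: mult_ac)
  qed (use \<delta> in auto)
  also have "\<dots> = K / \<beta> * (\<delta> powr (- \<mu>) * \<delta> powr \<beta>)" using \<beta> by simp
  also have "\<delta> powr (- \<mu>) * \<delta> powr \<beta> = \<delta> powr (\<beta> - \<mu>)"
    unfolding powr_add[symmetric] by simp
  finally have right: "norm (integral {1 - \<delta>..1} f) \<le> K / \<beta> * \<delta> powr (\<beta> - \<mu>)" .
  have "integral {0..1} f = integral {0..1 - \<delta>} f + integral {1 - \<delta>..1} f"
    using f \<delta> by (intro Henstock_Kurzweil_Integration.integral_combine[symmetric] integrable_continuous_real) auto
  then have "norm (integral {0..1} f) \<le> K / (\<mu> - \<beta>) * \<delta> powr (\<beta> - \<mu>) + K / \<beta> * \<delta> powr (\<beta> - \<mu>)"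
    using norm_triangle_ineq[of "integral {0..1 - \<delta>} f" "integral {1 - \<delta>..1} f"] left right by simp
  also have "\<dots> = K * (1 / \<beta> + 1 / (\<mu> - \<beta>)) * \<delta> powr (\<beta> - \<mu>)"
    by (simp add: algebra_simps)
  finally show ?thesis .
qed

lemma norm_circle_integral_le:
  assumes u: "continuous_on (sphere 0 1) u" and w: "w integrable_on {0..2 * pi}"
    and le: "\<And>t. norm (u (cis t)) \<le> w t"
  shows "norm (circle_integral u) \<le> integral {0..2 * pi} w"
  unfolding circle_integral_def
  by (intro Henstock_Kurzweil_Integration.integral_norm_bound_integral circle_integrable u w le)

text \<open>
  The radius \<open>r\<close> is shared between the two factors. With all of it on
  \<open>D\<close> the kernel would stay on the circle and cost a factor \<open>1 / (1 - norm z) ^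
  m\<close> for every \<open>r\<close>, too much for \<open>r\<close> far from 1.
\<close>

lemma dilated_pairing_bound:
  fixes D \<theta> :: "complex \<Rightarrow> complex"
  assumes D: "continuous_on (cball 0 1) D" "D holomorphic_on ball 0 1"
    and D_le: "\<And>w. w \<in> ball 0 1 \<Longrightarrow> norm (D w) \<le> C * (1 - norm w) powr (- \<gamma>)" and "C \<ge> 0"
    and \<theta>: "continuous_on (cball 0 1) \<theta>" "\<theta> holomorphic_on ball 0 1"
    and \<theta>_le: "\<And>w. w \<in> ball 0 1 \<Longrightarrow> norm (\<theta> w) \<le> M"
    and z: "z \<in> ball 0 1" and m: "m > 0" and r: "0 < r" "r < 1"
  shows "norm (circle_integral (\<lambda>\<zeta>. D (of_real r * \<zeta>) * cnj (\<theta> \<zeta> / (1 - cnj z * \<zeta>) ^ Suc m))) \<le>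
    C * (1 - sqrt r) powr (- \<gamma>) * M * (2 * pi / (1 - sqrt r * norm z) ^ m)"
proof -
  define s where "s = sqrt r"
  have s: "0 < s" "s < 1" using r by (auto simp: s_def real_sqrt_lt_1_iff)
  have "M \<ge> 0" using \<theta>_le[of 0] norm_ge_zero[of "\<theta> 0"] by (simp del: norm_ge_zero)
  have nz: "1 - cnj z * w \<noteq> 0" if "w \<in> cball 0 1" for w
    using one_minus_mult_nonzero[of w "cnj z"] that z by (simp add: mult.commute)
  define \<kappa> where "\<kappa> w = \<theta> w / (1 - cnj z * w) ^ Suc m" for w
  have \<kappa>: "continuous_on (cball 0 1) \<kappa>" "\<kappa> holomorphic_on ball 0 1"
    unfolding \<kappa>_def using \<theta> nz by (auto intro!: continuous_intros holomorphic_intros)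
  define a where "a = cnj z * of_real s"
  have na: "norm a = s * norm z" using s by (simp add: a_def norm_mult)
  have "s * norm z \<le> 1 * norm z" using s by (intro mult_right_mono) auto
  then have a1: "norm a < 1" using na z by simp
  have anz: "1 - a * cis t \<noteq> 0" for t
    using one_minus_mult_nonzero[of "cis t" a] a1 by (simp add: mult.commute)
  have "circle_integral (\<lambda>\<zeta>. D (of_real r * \<zeta>) * cnj (\<kappa> \<zeta>)) =
      circle_integral (\<lambda>\<zeta>. D (of_real s * \<zeta>) * cnj (\<kappa> (of_real s * \<zeta>)))"
    unfolding s_def using r by (intro circle_pairing_dilate D \<kappa>) auto
  also have "norm \<dots> \<le> integral {0..2 * pi} (\<lambda>t. C * (1 - s) powr (- \<gamma>) * M * (1 / norm (1 - a * cis t) ^ Suc m))"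
  proof (rule norm_circle_integral_le)
    have "continuous_on (cball 0 1) (\<lambda>\<zeta>. D (of_real s * \<zeta>))" "continuous_on (cball 0 1) (\<lambda>\<zeta>. \<kappa> (of_real s * \<zeta>))"
      using dilated_on_disc(1)[OF D] dilated_on_disc(1)[OF \<kappa>] s by auto
    then show "continuous_on (sphere 0 1) (\<lambda>\<zeta>. D (of_real s * \<zeta>) * cnj (\<kappa> (of_real s * \<zeta>)))"
      by (intro continuous_intros) (auto intro: continuous_on_subset)
    show "(\<lambda>t. C * (1 - s) powr (- \<gamma>) * M * (1 / norm (1 - a * cis t) ^ Suc m)) integrable_on {0..2 * pi}"
      using anz by (intro integrable_continuous_real continuous_intros) auto
    fix t
    have sin: "of_real s * cis t \<in> ball 0 1" "norm (of_real s * cis t) = s" using s by (auto simp: norm_mult)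
    have "norm (D (of_real s * cis t)) \<le> C * (1 - s) powr (- \<gamma>)"
      using D_le[OF sin(1)] unfolding sin(2) .
    moreover have "norm (\<kappa> (of_real s * cis t)) \<le> M * (1 / norm (1 - a * cis t) ^ Suc m)"
      using \<theta>_le[OF sin(1)] unfolding \<kappa>_def a_def norm_divide norm_power mult.assoc
      by (simp add: divide_right_mono)
    ultimately have "norm (D (of_real s * cis t)) * norm (\<kappa> (of_real s * cis t)) \<le>
        (C * (1 - s) powr (- \<gamma>)) * (M * (1 / norm (1 - a * cis t) ^ Suc m))"
      using \<open>C \<ge> 0\<close> by (intro mult_mono) auto
    then show "norm (D (of_real s * cis t) * cnj (\<kappa> (of_real s * cis t))) \<le>
        C * (1 - s) powr (- \<gamma>) * M * (1 / norm (1 - a * cis t) ^ Suc m)"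
      unfolding norm_mult complex_mod_cnj by (simp only: mult.assoc)
  qed
  also have "\<dots> = C * (1 - s) powr (- \<gamma>) * M * integral {0..2 * pi} (\<lambda>t. 1 / norm (1 - a * cis t) ^ Suc m)"
    by (rule integral_mult_right)
  also have "\<dots> \<le> C * (1 - s) powr (- \<gamma>) * M * (2 * pi / (1 - norm a) ^ m)"
    using \<open>C \<ge> 0\<close> \<open>M \<ge> 0\<close> by (intro mult_left_mono circle_kernel_bound a1 m mult_nonneg_nonneg) auto
  finally show ?thesis by (simp only: \<kappa>_def na s_def)
qed

text \<open>
  This is the estimate for the \<open>m\<close>-th derivative of the Cauchy integral of \<open>h *
  cnj \<theta>\<close> at \<open>z\<close>, in the form of a pairing; the bound depends on
  \<open>h\<close> and \<open>\<theta>\<close> only through \<open>C\<close> and \<open>M\<close>,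
  not through \<open>\<rho>\<close>, and therefore applies uniformly to dilations of functions on
  the open disc. After Taylor's formula the integrand at \<open>r\<close> is at most a constant
  times \<open>(1 - r) powr (\<beta> - 1)\<close> times the power \<open>- m\<close> of the larger
  of \<open>1 - norm z\<close> and \<open>1 - r\<close>.
\<close>

lemma pairing_bound:
  fixes h \<theta> :: "complex \<Rightarrow> complex"
  assumes h: "h holomorphic_on ball 0 \<rho>" "\<rho> > 1"
    and h_le: "\<And>w. w \<in> ball 0 1 \<Longrightarrow> norm ((deriv ^^ m) h w) \<le> C * (1 - norm w) powr (- (real m - \<beta>))"
    and \<theta>: "continuous_on (cball 0 1) \<theta>" "\<theta> holomorphic_on ball 0 1"
    and \<theta>_le: "\<And>w. w \<in> ball 0 1 \<Longrightarrow> norm (\<theta> w) \<le> M"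
    and z: "z \<in> ball 0 1" and \<beta>: "0 < \<beta>" "\<beta> < real m"
  shows "norm (circle_integral (\<lambda>\<zeta>. h \<zeta> * cnj (\<zeta> ^ m * (\<theta> \<zeta> / (1 - cnj z * \<zeta>) ^ Suc m)))) \<le>
    (2 * pi * 4 ^ m * C * M) * (1 / \<beta> + 1 / (real m - \<beta>)) * (1 - norm z) powr (\<beta> - real m)"
proof -
  have m: "m > 0" using \<beta> by (cases m) auto
  have M: "M \<ge> 0" using \<theta>_le[of 0] norm_ge_zero[of "\<theta> 0"] by (simp del: norm_ge_zero)
  have C: "C \<ge> 0" using h_le[of 0] norm_ge_zero[of "(deriv ^^ m) h 0"] by (simp del: norm_ge_zero)
  define \<delta> where "\<delta> = 1 - norm z"
  have \<delta>: "0 < \<delta>" "\<delta> \<le> 1" using z by (auto simp: \<delta>_def)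
  define D where "D = (deriv ^^ m) h"
  have D\<rho>: "D holomorphic_on ball 0 \<rho>"
    unfolding D_def using h by (intro holomorphic_higher_deriv) auto
  note D = holomorphic_larger_disc[OF D\<rho> h(2)]
  define \<kappa> where "\<kappa> w = \<theta> w / (1 - cnj z * w) ^ Suc m" for w
  have nz: "1 - cnj z * w \<noteq> 0" if "w \<in> cball 0 1" for w
    using one_minus_mult_nonzero[of w "cnj z"] that z by (simp add: mult.commute)
  have \<kappa>: "continuous_on (cball 0 1) \<kappa>" "\<kappa> holomorphic_on ball 0 1"
    unfolding \<kappa>_def using \<theta> nz by (auto intro!: continuous_intros holomorphic_intros)
  define I where "I r = circle_integral (\<lambda>\<zeta>. D (of_real r * \<zeta>) * cnj (\<kappa> \<zeta>))" for r
  define f where "f r = of_real ((1 - r) ^ (m - 1) / fact (m - 1)) * I r" for r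
  have contf: "continuous_on {0..1} f"
  proof -
    have "continuous_on {0..1} (\<lambda>r. integral (cbox 0 (2 * pi)) (\<lambda>t. D (of_real r * cis t) * cnj (\<kappa> (cis t))))"
    proof (intro integral_continuous_on_param, unfold case_prod_unfold, intro continuous_intros)
      show "continuous_on ({0..1} \<times> cbox 0 (2 * pi)) (\<lambda>x :: real \<times> real. D (of_real (fst x) * cis (snd x)))"
        by (rule continuous_on_compose2[OF D(1)]) (auto intro!: continuous_intros simp: norm_mult)
      show "continuous_on ({0..1} \<times> cbox 0 (2 * pi)) (\<lambda>x :: real \<times> real. \<kappa> (cis (snd x)))"
        by (rule continuous_on_compose2[OF \<kappa>(1)]) (auto intro!: continuous_intros)
    qed
    then have "continuous_on {0..1} I" unfolding I_def circle_integral_def by simp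
    then show ?thesis unfolding f_def by (intro continuous_intros) auto
  qed
  have bound: "norm (f r) \<le> (2 * pi * 4 ^ m * C * M) * ((1 - r) powr (\<beta> - 1) * X)"
    if r: "0 < r" "r < 1" and X: "1 / (1 - sqrt r * norm z) ^ m \<le> 2 ^ m * X" for r X
  proof -
    define s where "s = sqrt r"
    have s: "0 < s" "s < 1" "s * s = r" using r by (auto simp: s_def real_sqrt_lt_1_iff)
    have "1 - r = (1 - s) * (1 + s)" using s by (simp add: algebra_simps)
    also have "\<dots> \<le> (1 - s) * 2" using s by (intro mult_left_mono) auto
    finally have half: "(1 - r) / 2 \<le> 1 - s" by simp
    \<comment> \<open>Passing from \<open>r\<close> to its square root changes distances to 1 by a factor of at
      most 2; the powers of 2 collected here and in the assumption on \<open>X\<close> make up the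
      constant \<open>4 ^ m\<close>.\<close>
    have "(1 - s) powr (- (real m - \<beta>)) \<le> ((1 - r) / 2) powr (- (real m - \<beta>))"
      using half r \<beta> by (intro powr_mono2') auto
    also have "\<dots> = 2 powr (real m - \<beta>) * (1 - r) powr (\<beta> - real m)"
      using r powr_minus_divide[of 2 "real m - \<beta>"] by (simp add: powr_divide)
    also have "\<dots> \<le> 2 powr real m * (1 - r) powr (\<beta> - real m)"
      using \<beta> by (intro mult_right_mono powr_mono) auto
    finally have s_le: "(1 - s) powr (- (real m - \<beta>)) \<le> 2 ^ m * (1 - r) powr (\<beta> - real m)"
      by (simp add: powr_realpow)
    have "norm (I r) \<le> C * (1 - s) powr (- (real m - \<beta>)) * M * (2 * pi / (1 - s * norm z) ^ m)"
      unfolding I_def \<kappa>_def s_def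
      using h_le C unfolding D_def[symmetric] by (intro dilated_pairing_bound D \<theta> \<theta>_le z m r) auto
    also have "\<dots> = C * (1 - s) powr (- (real m - \<beta>)) * M * (2 * pi) * (1 / (1 - s * norm z) ^ m)"
      by simp
    also have "\<dots> \<le> C * (2 ^ m * (1 - r) powr (\<beta> - real m)) * M * (2 * pi) * (2 ^ m * X)"
    proof (intro mult_mono s_le order.refl)
      have "s * norm z \<le> 1 * norm z" using s by (intro mult_right_mono) auto
      then show "0 \<le> 1 / (1 - s * norm z) ^ m" using z by simp
    qed (use X C M in \<open>auto simp: s_def\<close>)
    also have "\<dots> = (2 * pi * 4 ^ m * C * M) * ((1 - r) powr (\<beta> - real m) * X)"
      by (simp add: mult_ac flip: power_mult_distrib)
    finally have "norm (I r) \<le> (2 * pi * 4 ^ m * C * M) * ((1 - r) powr (\<beta> - real m) * X)" .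
    moreover have "(1 - r) ^ (m - 1) / fact (m - 1) \<le> (1 - r) ^ (m - 1) / 1"
      using r by (intro divide_left_mono) auto
    ultimately have "(1 - r) ^ (m - 1) / fact (m - 1) * norm (I r) \<le>
        (1 - r) ^ (m - 1) * ((2 * pi * 4 ^ m * C * M) * ((1 - r) powr (\<beta> - real m) * X))"
      using r by (intro mult_mono) auto
    also have "\<dots> = (2 * pi * 4 ^ m * C * M) * ((1 - r) ^ (m - 1) * (1 - r) powr (\<beta> - real m) * X)"
      by (simp only: mult_ac)
    also have "(1 - r) ^ (m - 1) * (1 - r) powr (\<beta> - real m) = (1 - r) powr (real (m - 1) + (\<beta> - real m))"
      unfolding powr_add using r by (simp add: powr_realpow)
    also have "real (m - 1) + (\<beta> - real m) = \<beta> - 1" using m by simp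
    finally show ?thesis
      using r unfolding f_def norm_mult norm_of_real by simp
  qed
  have "norm (integral {0..1} f) \<le> (2 * pi * 4 ^ m * C * M) * (1 / \<beta> + 1 / (real m - \<beta>)) * \<delta> powr (\<beta> - real m)"
  proof (rule weighted_integral_bound[OF contf \<delta> \<beta>])
    fix r :: real assume r: "0 < r" "r < 1"
    define s where "s = sqrt r"
    have s: "0 < s" "s < 1" "s * s = r" using r by (auto simp: s_def real_sqrt_lt_1_iff)
    have "s * norm z \<le> 1 * norm z" using s by (intro mult_right_mono) auto
    then have d: "\<delta> \<le> 1 - s * norm z" by (simp add: \<delta>_def)
    have "s * norm z \<le> s * 1" using s z by (intro mult_left_mono) auto
    moreover have "1 - r = (1 - s) * (1 + s)" using s by (simp add: algebra_simps)
    moreover have "\<dots> \<le> (1 - s) * 2" using s by (intro mult_left_mono) auto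
    ultimately have half: "(1 - r) / 2 \<le> 1 - s * norm z" by simp
    have "1 / (1 - s * norm z) ^ m \<le> 1 / \<delta> ^ m"
      using d \<delta> by (intro divide_left_mono power_mono mult_pos_pos zero_less_power) auto
    also have "1 / \<delta> ^ m \<le> 2 ^ m * (1 / \<delta> ^ m)"
      using \<delta> by (simp add: divide_right_mono)
    also have "1 / \<delta> ^ m = \<delta> powr (- real m)" using \<delta> by (simp add: powr_minus_divide powr_realpow)
    finally show "norm (f r) \<le> (2 * pi * 4 ^ m * C * M) * ((1 - r) powr (\<beta> - 1) * \<delta> powr (- real m))"
      by (intro bound r) (simp add: s_def)
    have "1 / (1 - s * norm z) ^ m \<le> 1 / ((1 - r) / 2) ^ m"
      using half r d \<delta> by (intro divide_left_mono power_mono mult_pos_pos zero_less_power) auto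
    also have "\<dots> = 2 ^ m * (1 - r) powr (- real m)"
      using r by (simp add: power_divide powr_minus_divide powr_realpow)
    finally show "norm (f r) \<le> (2 * pi * 4 ^ m * C * M) * ((1 - r) powr (\<beta> - 1) * (1 - r) powr (- real m))"
      by (intro bound r) (simp add: s_def)
  qed (use C M in auto)
  moreover have "circle_integral (\<lambda>\<zeta>. h \<zeta> * cnj (\<zeta> ^ m * \<kappa> \<zeta>)) = integral {0..1} f"
    unfolding f_def I_def D_def by (rule circle_pairing_radial_Taylor[OF h \<kappa> m])
  ultimately show ?thesis unfolding \<kappa>_def \<delta>_def by simp
qed

section \<open>Division by an inner function\<close>

text \<open>
  Dominated convergence: the radial limits exist almost everywhere and have modulus 1, and
  \<open>\<theta>\<close> is bounded. The boundary condition on \<open>\<theta>\<close> enters the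
  proof here.
\<close>

lemma inner_function_modulus_mean:
  assumes \<theta>: "inner_function \<theta>" and R: "\<And>n. 0 < R n" "\<And>n. R n < 1" "R \<longlonglongrightarrow> 1"
  shows "(\<lambda>n. integral {0..2 * pi} (\<lambda>t. \<bar>1 - norm (\<theta> (of_real (R n) * cis t)) ^ 2\<bar>)) \<longlonglongrightarrow> 0"
proof -
  have hol: "\<theta> holomorphic_on ball 0 1" using \<theta> by (simp add: inner_function_def)
  obtain M where M: "\<And>w. w \<in> ball 0 1 \<Longrightarrow> norm (\<theta> w) \<le> M"
    using \<theta> unfolding inner_function_def bounded_iff by blast
  have ball: "of_real (R n) * cis t \<in> ball 0 1" for n t
    using R(1,2)[of n] by (simp add: norm_mult)
  define s where "s n t = \<bar>1 - norm (\<theta> (of_real (R n) * cis t)) ^ 2\<bar>" for n t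
  have "continuous_on {0..2 * pi} (\<lambda>t. \<theta> (of_real (R n) * cis t))" for n
    by (rule continuous_on_compose2[OF holomorphic_on_imp_continuous_on[OF hol]])
      (use ball in \<open>auto intro!: continuous_intros simp del: mem_ball_0\<close>)
  then have int: "integrable (lebesgue_on {0..2 * pi}) (s n)" for n
    unfolding s_def by (intro continuous_imp_integrable_real continuous_intros)
  have "(\<lambda>n. integral\<^sup>L (lebesgue_on {0..2 * pi}) (s n)) \<longlonglongrightarrow> integral\<^sup>L (lebesgue_on {0..2 * pi}) (\<lambda>t. 0)"
  proof (rule integral_dominated_convergence[where w = "\<lambda>t. 1 + M ^ 2"])
    show "s n \<in> borel_measurable (lebesgue_on {0..2 * pi})" for n
      using int by (rule borel_measurable_integrable)
    show "integrable (lebesgue_on {0..2 * pi}) (\<lambda>t. 1 + M ^ 2)"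
      by (intro continuous_imp_integrable_real continuous_intros)
    have "AE t in lebesgue_on {0..2 * pi}. ((\<lambda>r::real. norm (\<theta> (of_real r * cis t))) \<longlongrightarrow> 1) (at_left 1)"
      using \<theta> by (simp add: inner_function_def)
    then show "AE t in lebesgue_on {0..2 * pi}. (\<lambda>n. s n t) \<longlonglongrightarrow> 0"
    proof eventually_elim
      case (elim t)
      have "filterlim R (at_left 1) sequentially"
        using R by (intro tendsto_imp_filterlim_at_left always_eventually) auto
      from filterlim_compose[OF elim this]
      have "(\<lambda>n. norm (\<theta> (of_real (R n) * cis t))) \<longlonglongrightarrow> 1" .
      then have "(\<lambda>n. s n t) \<longlonglongrightarrow> \<bar>1 - 1 ^ 2\<bar>"
        unfolding s_def by (intro tendsto_intros)
      then show ?case by simp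
    qed
    show "AE t in lebesgue_on {0..2 * pi}. norm (s n t) \<le> 1 + M ^ 2" for n
    proof (rule AE_I2)
      fix t
      have "norm (\<theta> (of_real (R n) * cis t)) ^ 2 \<le> M ^ 2"
        by (intro power_mono M ball) auto
      moreover have "0 \<le> norm (\<theta> (of_real (R n) * cis t)) ^ 2" by simp
      ultimately show "norm (s n t) \<le> 1 + M ^ 2" unfolding s_def real_norm_def by linarith
    qed
  qed simp
  moreover have "integral\<^sup>L (lebesgue_on {0..2 * pi}) (s n) = integral {0..2 * pi} (s n)" for n
    using int by (intro lebesgue_integral_eq_integral) auto
  ultimately show ?thesis by (simp add: s_def[abs_def])
qed

lemma dilate_holomorphic:
  fixes f :: "complex \<Rightarrow> complex"
  assumes "f holomorphic_on ball 0 1" "0 < R"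
  shows "(\<lambda>w. f (of_real R * w)) holomorphic_on ball 0 (1 / R)"
proof -
  have "(f \<circ> (\<lambda>w. of_real R * w)) holomorphic_on ball 0 (1 / R)"
    using assms by (intro holomorphic_on_compose_gen[of _ _ f "ball 0 1"] holomorphic_intros)
      (auto simp: norm_mult field_simps)
  then show ?thesis by (simp add: o_def)
qed

text \<open>
  On the circle of radius \<open>R\<close> write \<open>F = h * cnj \<theta> + F * (1 -
  \<bar>\<theta>\<bar>\<^sup>2)\<close> with \<open>h = F * \<theta>\<close>. In Cauchy's formula
  for the \<open>m\<close>-th derivative, the first summand is controlled by
  \<open>pairing_bound\<close> uniformly in \<open>R\<close>, and the second tends to 0 with
  \<open>R\<close> tending to 1, because \<open>F\<close> is bounded. Boundedness of
  \<open>F\<close> cannot be dropped: for a singular inner function \<open>\<theta>\<close> the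
  function \<open>1 / \<theta>\<close> is a counterexample.
\<close>

lemma A_class_divide_inner:
  assumes F: "F holomorphic_on ball 0 1" "growth 0 F" and \<theta>: "inner_function \<theta>"
    and prod: "(\<lambda>z. F z * \<theta> z) \<in> A_class \<beta>" and "\<beta> > 0"
  shows "F \<in> A_class \<beta>"
proof -
  define m where "m = least_nat_above \<beta>"
  have \<beta>: "0 < \<beta>" "\<beta> < real m" using least_nat_above[of \<beta>] \<open>\<beta> > 0\<close> by (auto simp: m_def)
  define h where "h z = F z * \<theta> z" for z
  have h: "h holomorphic_on ball 0 1" "growth (real m - \<beta>) ((deriv ^^ m) h)"
    using prod unfolding h_def[abs_def] m_def A_class_iff by blast+
  obtain C where C: "C > 0" "\<And>w. w \<in> ball 0 1 \<Longrightarrow> norm ((deriv ^^ m) h w) \<le> C * (1 - norm w) powr (- (real m - \<beta>))"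
    using growthE[OF h(2)] by blast
  have hol\<theta>: "\<theta> holomorphic_on ball 0 1" using \<theta> by (simp add: inner_function_def)
  obtain M where M: "\<And>w. w \<in> ball 0 1 \<Longrightarrow> norm (\<theta> w) \<le> M"
    using \<theta> unfolding inner_function_def bounded_iff by blast
  obtain B where B: "\<And>w. w \<in> ball 0 1 \<Longrightarrow> norm (F w) \<le> B"
    using F(2) unfolding growth_0_iff bounded_iff by blast
  have "B \<ge> 0" using B[of 0] norm_ge_zero[of "F 0"] by (simp del: norm_ge_zero)
  define K where "K = (2 * pi * 4 ^ m * C * M) * (1 / \<beta> + 1 / (real m - \<beta>))"
  define R where "R n = 1 - 1 / real (n + 2)" for n
  have R: "0 < R n" "R n < 1" for n by (auto simp: R_def field_simps)
  have R1: "R \<longlonglongrightarrow> 1"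
  proof -
    have "(\<lambda>n. 1 - 1 / real (n + 2)) \<longlonglongrightarrow> 1 - 0"
      by (intro tendsto_diff tendsto_const LIMSEQ_ignore_initial_segment[OF lim_1_over_n])
    then show ?thesis by (simp add: R_def[abs_def])
  qed
  have "norm ((deriv ^^ m) F z) \<le> (fact m / (2 * pi) * K) * (1 - norm z) powr (- (real m - \<beta>))"
    if z: "z \<in> ball 0 1" for z
  proof -
    define \<delta> where "\<delta> = 1 - norm z"
    have \<delta>: "0 < \<delta>" using z by (simp add: \<delta>_def)
    \<comment> \<open>Bounds the error on the circle of radius \<open>R n\<close>, up to a constant that depends
      on \<open>z\<close>.\<close>
    define E where "E n = integral {0..2 * pi} (\<lambda>t. \<bar>1 - norm (\<theta> (of_real (R n) * cis t)) ^ 2\<bar>)" for n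
    have E: "E \<longlonglongrightarrow> 0" unfolding E_def by (rule inner_function_modulus_mean[OF \<theta> R R1])
    have le: "norm (of_real (2 * pi / fact m) * (of_real (R n) ^ m * (deriv ^^ m) F (of_real (R n) * z))) \<le>
        K * \<delta> powr (\<beta> - real m) + B / \<delta> ^ Suc m * E n" for n
    proof -
      define r where "r = complex_of_real (R n)"
      have inv: "1 / R n > 1" using R[of n] by simp
      have rball: "r * w \<in> ball 0 1" if "w \<in> cball 0 1" for w
      proof -
        have "norm (r * w) \<le> R n * 1"
          unfolding norm_mult r_def using that R(1)[of n] by (intro mult_mono) auto
        then show ?thesis using R(2)[of n] by simp
      qed
      have nz: "1 - cnj w * z \<noteq> 0" "1 - w * cnj z \<noteq> 0" if "w \<in> cball 0 1" for w
        using one_minus_mult_nonzero[of "cnj w" z] one_minus_mult_nonzero[of w "cnj z"] that z by auto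
      have dil: "(\<lambda>w. h (r * w)) holomorphic_on ball 0 (1 / R n)"
        "(\<lambda>w. \<theta> (r * w)) holomorphic_on ball 0 (1 / R n)" "(\<lambda>w. F (r * w)) holomorphic_on ball 0 (1 / R n)"
        unfolding r_def using R(1) h(1) hol\<theta> F(1) by (auto intro: dilate_holomorphic)
      note Fr = holomorphic_larger_disc[OF dil(3) inv] and \<theta>r = holomorphic_larger_disc[OF dil(2) inv]
      have deriv_dil: "(deriv ^^ m) (\<lambda>w. f (r * w)) w = r ^ m * (deriv ^^ m) f (r * w)"
        if "f holomorphic_on ball 0 1" "w \<in> ball 0 1" for f w
        using that rball by (intro higher_deriv_compose_linear[where S = "ball 0 1" and T = "ball 0 1"])
          (auto simp del: mem_ball_0 mem_cball_0)
      define k where "k \<zeta> = cnj \<zeta> ^ m / (1 - cnj \<zeta> * z) ^ Suc m" for \<zeta>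
      \<comment> \<open>The Cauchy formula for \<open>F\<close> is the sum of \<open>A\<close>, bounded uniformly
        in \<open>n\<close>, and of the error \<open>A'\<close> below.\<close>
      define A where "A = circle_integral (\<lambda>\<zeta>. h (r * \<zeta>) * cnj (\<theta> (r * \<zeta>)) * k \<zeta>)"
      have "norm A \<le> K * \<delta> powr (\<beta> - real m)"
      proof -
        have "A = circle_integral (\<lambda>\<zeta>. h (r * \<zeta>) * cnj (\<zeta> ^ m * (\<theta> (r * \<zeta>) / (1 - cnj z * \<zeta>) ^ Suc m)))"
          unfolding A_def k_def by (rule circle_integral_cong) (simp add: mult_ac)
        also have "norm \<dots> \<le> K * \<delta> powr (\<beta> - real m)"
          unfolding K_def \<delta>_def
        proof (rule pairing_bound[OF dil(1) inv _ \<theta>r _ z \<beta>])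
          fix w :: complex assume w: "w \<in> ball 0 1"
          then have rw: "r * w \<in> ball 0 1" by (intro rball) auto
          show "norm (\<theta> (r * w)) \<le> M" by (rule M[OF rw])
          have "norm (r * w) \<le> norm w"
            using R[of n] by (simp add: r_def norm_mult mult_left_le_one_le)
          then have "(1 - norm (r * w)) powr (- (real m - \<beta>)) \<le> (1 - norm w) powr (- (real m - \<beta>))"
            using w \<beta> by (intro powr_mono2') auto
          then have "C * (1 - norm (r * w)) powr (- (real m - \<beta>)) \<le> C * (1 - norm w) powr (- (real m - \<beta>))"
            using C(1) by simp
          with C(2)[OF rw] have *: "norm ((deriv ^^ m) h (r * w)) \<le> C * (1 - norm w) powr (- (real m - \<beta>))"
            by (rule order_trans)
          have "norm ((deriv ^^ m) (\<lambda>w. h (r * w)) w) = R n ^ m * norm ((deriv ^^ m) h (r * w))"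
            unfolding deriv_dil[OF h(1) w] using R(1)[of n] by (simp add: norm_mult norm_power r_def)
          also have "\<dots> \<le> norm ((deriv ^^ m) h (r * w))"
            using R[of n] by (intro mult_left_le_one_le power_le_one) auto
          also note *
          finally show "norm ((deriv ^^ m) (\<lambda>w. h (r * w)) w) \<le> C * (1 - norm w) powr (- (real m - \<beta>))" .
        qed
        finally show ?thesis .
      qed
      define A' where "A' = circle_integral (\<lambda>\<zeta>. F (r * \<zeta>) * of_real (1 - norm (\<theta> (r * \<zeta>)) ^ 2) * k \<zeta>)"
      have contk: "continuous_on (sphere 0 1) k"
        unfolding k_def using nz(1) by (intro continuous_intros) auto
      have cont: "continuous_on (sphere 0 1) (\<lambda>\<zeta>. F (r * \<zeta>))" "continuous_on (sphere 0 1) (\<lambda>\<zeta>. \<theta> (r * \<zeta>))"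
        using Fr(1) \<theta>r(1) by (auto elim!: continuous_on_subset)
      have conth: "continuous_on (sphere 0 1) (\<lambda>\<zeta>. h (r * \<zeta>))"
        unfolding h_def by (intro continuous_intros cont)
      have "norm A' \<le> integral {0..2 * pi} (\<lambda>t. B / \<delta> ^ Suc m * \<bar>1 - norm (\<theta> (r * cis t)) ^ 2\<bar>)"
        unfolding A'_def
      proof (rule norm_circle_integral_le)
        show "continuous_on (sphere 0 1) (\<lambda>\<zeta>. F (r * \<zeta>) * of_real (1 - norm (\<theta> (r * \<zeta>)) ^ 2) * k \<zeta>)"
          by (intro continuous_intros cont contk)
        show "(\<lambda>t. B / \<delta> ^ Suc m * \<bar>1 - norm (\<theta> (r * cis t)) ^ 2\<bar>) integrable_on {0..2 * pi}"
          by (intro integrable_continuous_real continuous_intros continuous_on_circle[OF cont(2)])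
        fix t
        have "norm (cnj (cis t) * z) = norm z" by (simp add: norm_mult)
        then have "\<delta> \<le> norm (1 - cnj (cis t) * z)"
          using norm_triangle_ineq2[of 1 "cnj (cis t) * z"] by (simp add: \<delta>_def)
        then have "norm (k (cis t)) \<le> 1 / \<delta> ^ Suc m"
          unfolding k_def norm_divide norm_power using \<delta>
          by (intro frac_le power_mono) (auto simp: power_one_over)
        moreover have "norm (F (r * cis t)) \<le> B" by (intro B rball) auto
        ultimately have "norm (F (r * cis t)) * norm (k (cis t)) * \<bar>1 - norm (\<theta> (r * cis t)) ^ 2\<bar> \<le>
            B * (1 / \<delta> ^ Suc m) * \<bar>1 - norm (\<theta> (r * cis t)) ^ 2\<bar>"
          using \<open>B \<ge> 0\<close> by (intro mult_right_mono mult_mono) auto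
        then show "norm (F (r * cis t) * of_real (1 - norm (\<theta> (r * cis t)) ^ 2) * k (cis t)) \<le>
            B / \<delta> ^ Suc m * \<bar>1 - norm (\<theta> (r * cis t)) ^ 2\<bar>"
          unfolding norm_mult norm_of_real by (simp add: mult_ac)
      qed
      also have "\<dots> = B / \<delta> ^ Suc m * E n"
        unfolding E_def r_def by (rule integral_mult_right)
      finally have A': "norm A' \<le> B / \<delta> ^ Suc m * E n" .
      have "A + A' = circle_integral (\<lambda>\<zeta>. F (r * \<zeta>) * k \<zeta>)"
      proof -
        have "A + A' = circle_integral (\<lambda>\<zeta>. h (r * \<zeta>) * cnj (\<theta> (r * \<zeta>)) * k \<zeta> +
            F (r * \<zeta>) * of_real (1 - norm (\<theta> (r * \<zeta>)) ^ 2) * k \<zeta>)"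
          unfolding A_def A'_def circle_integral_def
          by (intro Henstock_Kurzweil_Integration.integral_add[symmetric] integrable_continuous_real continuous_intros
              continuous_on_circle[OF cont(1)] continuous_on_circle[OF cont(2)] continuous_on_circle[OF contk]
              continuous_on_circle[OF conth])
        also have "\<dots> = circle_integral (\<lambda>\<zeta>. F (r * \<zeta>) * k \<zeta>)"
        proof (rule circle_integral_cong)
          fix \<zeta>
          have "of_real (1 - norm (\<theta> (r * \<zeta>)) ^ 2) = 1 - \<theta> (r * \<zeta>) * cnj (\<theta> (r * \<zeta>))"
            unfolding of_real_diff complex_norm_square by simp
          then show "h (r * \<zeta>) * cnj (\<theta> (r * \<zeta>)) * k \<zeta> + F (r * \<zeta>) * of_real (1 - norm (\<theta> (r * \<zeta>)) ^ 2) * k \<zeta>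
              = F (r * \<zeta>) * k \<zeta>"
            by (simp add: h_def algebra_simps)
        qed
        finally show ?thesis .
      qed
      also have "\<dots> = 2 * pi / fact m * (deriv ^^ m) (\<lambda>w. F (r * w)) z"
        using Cauchy_circle[OF Fr z, of m] by (simp add: k_def)
      also have "\<dots> = of_real (2 * pi / fact m) * (r ^ m * (deriv ^^ m) F (r * z))"
        unfolding deriv_dil[OF F(1) z] by simp
      finally have "norm (of_real (2 * pi / fact m) * (r ^ m * (deriv ^^ m) F (r * z))) = norm (A + A')"
        by simp
      also have "\<dots> \<le> norm A + norm A'" by (rule norm_triangle_ineq)
      finally show ?thesis
        using A' \<open>norm A \<le> K * \<delta> powr (\<beta> - real m)\<close> unfolding r_def by linarith
    qed
    have "(\<lambda>n. norm (of_real (2 * pi / fact m) * (of_real (R n) ^ m * (deriv ^^ m) F (of_real (R n) * z)))) \<longlonglongrightarrow>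
        norm (of_real (2 * pi / fact m) * (of_real 1 ^ m * (deriv ^^ m) F (of_real 1 * z)))"
    proof (intro tendsto_intros R1)
      have "isCont ((deriv ^^ m) F) (of_real 1 * z)"
        using F(1) z holomorphic_on_imp_continuous_on[OF holomorphic_higher_deriv[OF F(1), of m]]
        by (simp add: continuous_on_eq_continuous_at)
      moreover have "(\<lambda>n. of_real (R n) * z) \<longlonglongrightarrow> of_real 1 * z" by (intro tendsto_intros R1)
      ultimately show "(\<lambda>n. (deriv ^^ m) F (of_real (R n) * z)) \<longlonglongrightarrow> (deriv ^^ m) F (of_real 1 * z)"
        by (rule isCont_tendsto_compose)
    qed
    moreover have "(\<lambda>n. K * \<delta> powr (\<beta> - real m) + B / \<delta> ^ Suc m * E n) \<longlonglongrightarrow>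
        K * \<delta> powr (\<beta> - real m) + B / \<delta> ^ Suc m * 0"
      by (intro tendsto_intros E)
    ultimately have "norm (of_real (2 * pi / fact m) * (of_real 1 ^ m * (deriv ^^ m) F (of_real 1 * z))) \<le>
        K * \<delta> powr (\<beta> - real m) + B / \<delta> ^ Suc m * 0"
      using le by (intro LIMSEQ_le[of _ _ "\<lambda>n. K * \<delta> powr (\<beta> - real m) + B / \<delta> ^ Suc m * E n"]) auto
    then have "2 * pi / fact m * norm ((deriv ^^ m) F z) \<le> K * \<delta> powr (\<beta> - real m)"
      by (simp add: norm_mult norm_divide)
    then show ?thesis unfolding \<delta>_def by (simp add: field_simps)
  qed
  then have "growth (real m - \<beta>) ((deriv ^^ m) F)" unfolding growth_def by blast
  with F(1) show ?thesis unfolding A_class_iff m_def by blast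
qed

section \<open>Derivatives of strongly multipliable functions\<close>

text \<open>
  The differentiated products \<open>g' * \<theta> ^ j + j * g * \<theta> ^ (j - 1) *
  \<theta>'\<close> belong to the class for every \<open>j\<close>, but each power of
  \<open>\<theta>\<close> yields only one of them. Cancelling one factor \<open>\<theta>\<close>
  from the product for \<open>j = k + 1\<close> gives a second combination with the same powers of
  \<open>\<theta>\<close> as for \<open>j = k\<close>, and \<open>g' * \<theta> ^ k\<close> is
  obtained by elimination. The cancellation requires a bounded quotient: \<open>g'\<close> is
  bounded by \<open>j = 0\<close>, and hence \<open>g * \<theta>'\<close> is bounded by \<open>j =
  1\<close>.
\<close>

lemma derivative_times_inner_powers:
  assumes g: "g holomorphic_on ball 0 1" and \<theta>: "inner_function \<theta>" and "\<beta> > 0"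
    and mult: "\<And>k. (\<lambda>z. g z * \<theta> z ^ k) \<in> A_class (\<beta> + 1)"
  shows "(\<lambda>z. deriv g z * \<theta> z ^ k) \<in> A_class \<beta>"
proof -
  have hol\<theta>: "\<theta> holomorphic_on ball 0 1" and "growth 0 \<theta>"
    using \<theta> by (simp_all add: inner_function_def growth_0_iff)
  have d: "(\<lambda>z. deriv g z * \<theta> z ^ j + of_nat j * (g z * \<theta> z ^ (j - 1) * deriv \<theta> z)) \<in> A_class \<beta>" for j
  proof (rule A_class_cong[OF A_class_deriv[OF mult[of j] \<open>\<beta> > 0\<close>]])
    fix z :: complex assume z: "z \<in> ball 0 1"
    have "(g has_field_derivative deriv g z) (at z)" "(\<theta> has_field_derivative deriv \<theta> z) (at z)"
      using g hol\<theta> z by (auto intro!: holomorphic_derivI[of _ "ball 0 1"] simp del: mem_ball_0)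
    then have "((\<lambda>z. g z * \<theta> z ^ j) has_field_derivative
        deriv g z * \<theta> z ^ j + of_nat j * (g z * \<theta> z ^ (j - 1) * deriv \<theta> z)) (at z)"
      by (auto intro!: derivative_eq_intros simp: algebra_simps)
    then show "deriv (\<lambda>z. g z * \<theta> z ^ j) z = deriv g z * \<theta> z ^ j + of_nat j * (g z * \<theta> z ^ (j - 1) * deriv \<theta> z)"
      by (rule DERIV_imp_deriv)
  qed
  show ?thesis
  proof (cases k)
    case 0
    with d[of 0] show ?thesis by simp
  next
    case (Suc i)
    \<comment> \<open>The product for \<open>j = k + 1\<close> with one factor \<open>\<theta>\<close> cancelled;
      \<open>i = k - 1\<close>.\<close>
    define F where "F z = deriv g z * \<theta> z ^ k + of_nat (k + 1) * (g z * \<theta> z ^ i * deriv \<theta> z)" for z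
    have bdd: "growth 0 (deriv g)" "growth 0 (\<lambda>z. deriv g z * \<theta> z + g z * deriv \<theta> z)"
      using A_class_bounded[OF d[of 0] \<open>\<beta> > 0\<close>] A_class_bounded[OF d[of 1] \<open>\<beta> > 0\<close>] by auto
    have pow: "growth 0 (\<lambda>z. \<theta> z ^ j)" for j
    proof (induction j)
      case (Suc j)
      from growth_mult[OF \<open>growth 0 \<theta>\<close> this] show ?case by simp
    qed (simp add: growth_const)
    \<comment> \<open>\<open>F\<close> in terms of the bounded functions \<open>g'\<close> and \<open>g' *
      \<theta> + g * \<theta>'\<close>.\<close>
    have "growth 0 (\<lambda>z. - of_nat k * (deriv g z * \<theta> z ^ k) +
        of_nat (k + 1) * ((deriv g z * \<theta> z + g z * deriv \<theta> z) * \<theta> z ^ i))"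
      using growth_add[OF growth_mult[OF growth_const[of 0] growth_mult[OF bdd(1) pow]]
          growth_mult[OF growth_const[of 0] growth_mult[OF bdd(2) pow]], of "- of_nat k" k "of_nat (k + 1)" i]
      by simp
    then have Fbdd: "growth 0 F"
    proof (rule growth_cong)
      fix z
      have "\<theta> z ^ k = \<theta> z * \<theta> z ^ i" by (simp add: Suc)
      then show "- of_nat k * (deriv g z * \<theta> z ^ k) + of_nat (k + 1) * ((deriv g z * \<theta> z + g z * deriv \<theta> z) * \<theta> z ^ i) = F z"
        unfolding F_def by (simp add: algebra_simps)
    qed
    have Fhol: "F holomorphic_on ball 0 1"
      unfolding F_def using g hol\<theta> by (intro holomorphic_intros) auto
    have F\<theta>: "(\<lambda>z. F z * \<theta> z) \<in> A_class \<beta>"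
    proof (rule A_class_cong[OF d[of "k + 1"]])
      fix z
      have "\<theta> z ^ (k + 1) = \<theta> z ^ k * \<theta> z" "\<theta> z ^ (k + 1 - 1) = \<theta> z ^ i * \<theta> z"
        by (simp_all add: Suc)
      then show "deriv g z * \<theta> z ^ (k + 1) + of_nat (k + 1) * (g z * \<theta> z ^ (k + 1 - 1) * deriv \<theta> z) = F z * \<theta> z"
        unfolding F_def by (simp only: distrib_left distrib_right mult_ac)
    qed
    have F: "F \<in> A_class \<beta>"
      by (rule A_class_divide_inner[OF Fhol Fbdd \<theta> F\<theta> \<open>\<beta> > 0\<close>])
    have "(\<lambda>z. of_nat (k + 1) * (deriv g z * \<theta> z ^ k + of_nat k * (g z * \<theta> z ^ (k - 1) * deriv \<theta> z)) + (- of_nat k) * F z) \<in> A_class \<beta>"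
      by (rule A_class_add[OF A_class_mult[OF A_class_const d] A_class_mult[OF A_class_const F]]) (use \<open>\<beta> > 0\<close> in auto)
    then show ?thesis
    proof (rule A_class_cong)
      fix z
      have "k - 1 = i" by (simp add: Suc)
      then show "of_nat (k + 1) * (deriv g z * \<theta> z ^ k + of_nat k * (g z * \<theta> z ^ (k - 1) * deriv \<theta> z)) + (- of_nat k) * F z
          = deriv g z * \<theta> z ^ k"
        unfolding F_def by (simp add: algebra_simps)
    qed
  qed
qed

lemma higher_deriv_times_inner_powers:
  assumes g: "g holomorphic_on ball 0 1" and \<theta>: "inner_function \<theta>"
    and mult: "\<And>k. (\<lambda>z. g z * \<theta> z ^ k) \<in> A_class \<alpha>" and "real i < \<alpha>"
  shows "(\<lambda>z. (deriv ^^ i) g z * \<theta> z ^ k) \<in> A_class (\<alpha> - real i)"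
  using \<open>real i < \<alpha>\<close>
proof (induction i arbitrary: k)
  case (Suc i)
  have "(\<lambda>z. deriv ((deriv ^^ i) g) z * \<theta> z ^ k) \<in> A_class (\<alpha> - real (Suc i))"
  proof (rule derivative_times_inner_powers[OF _ \<theta>])
    show "(deriv ^^ i) g holomorphic_on ball 0 1"
      using g by (intro holomorphic_higher_deriv) auto
    show "(\<lambda>z. (deriv ^^ i) g z * \<theta> z ^ k) \<in> A_class (\<alpha> - real (Suc i) + 1)" for k
      using Suc.IH[of k] Suc.prems by simp
  qed (use Suc.prems in simp)
  then show ?case by simp
qed (use mult in simp)

section \<open>Determinants and Wronskians\<close>

lemma A_class_det:
  assumes "\<beta> > 0" "\<And>i j. i < N \<Longrightarrow> j < N \<Longrightarrow> (\<lambda>z. a z i j) \<in> A_class \<beta>"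
  shows "(\<lambda>z. Determinant.det (mat N N (\<lambda>(i, j). a z i j))) \<in> A_class \<beta>"
proof -
  have "(\<lambda>z. \<Sum>p\<in>{p. p permutes {0..<N}}. signof p * (\<Prod>i = 0..<N. a z i (p i))) \<in> A_class \<beta>"
  proof (rule A_class_sum[OF assms(1)])
    fix p assume p: "p \<in> {p. p permutes {0..<N}}"
    have "(\<lambda>z. \<Prod>i = 0..<N. a z i (p i)) \<in> A_class \<beta>"
    proof (rule A_class_prod[OF assms(1)], rule assms(2))
      fix i assume "i \<in> {0..<N}"
      then show "i < N" "p i < N" using p permutes_in_image[of p "{0..<N}" i] by auto
    qed
    then show "(\<lambda>z. signof p * (\<Prod>i = 0..<N. a z i (p i))) \<in> A_class \<beta>"
      by (rule A_class_mult[OF A_class_const[OF assms(1)] _ assms(1)])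
  qed
  moreover have "Determinant.det (mat N N (\<lambda>(i, j). a z i j)) =
      (\<Sum>p\<in>{p. p permutes {0..<N}}. signof p * (\<Prod>i = 0..<N. a z i (p i)))" for z
  proof -
    have "mat N N (\<lambda>(i, j). a z i j) $$ (i, p i) = a z i (p i)" if "p permutes {0..<N}" "i \<in> {0..<N}" for p i
      using that permutes_in_image[of p "{0..<N}" i] by auto
    then show ?thesis
      by (subst det_def'[of _ N]) (auto intro!: sum.cong prod.cong)
  qed
  ultimately show ?thesis by simp
qed

lemma A_class_cofactor:
  assumes "\<beta> > 0" "\<And>i j. i < N \<Longrightarrow> j < N \<Longrightarrow> (\<lambda>z. a z i j) \<in> A_class \<beta>"
    and "p < N" "q < N"
  shows "(\<lambda>z. cofactor (mat N N (\<lambda>(i, j). a z i j)) p q) \<in> A_class \<beta>"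
proof -
  define b where "b z i j = a z (if i < p then i else Suc i) (if j < q then j else Suc j)" for z i j
  have "mat_delete (mat N N (\<lambda>(i, j). a z i j)) p q = mat (N - 1) (N - 1) (\<lambda>(i, j). b z i j)" for z
    unfolding mat_delete_def b_def by (intro eq_matI) auto
  then have "cofactor (mat N N (\<lambda>(i, j). a z i j)) p q =
      (- 1) ^ (p + q) * Determinant.det (mat (N - 1) (N - 1) (\<lambda>(i, j). b z i j))" for z
    unfolding cofactor_def by simp
  moreover have "(\<lambda>z. (- 1) ^ (p + q) * Determinant.det (mat (N - 1) (N - 1) (\<lambda>(i, j). b z i j))) \<in> A_class \<beta>"
  proof (rule A_class_mult[OF A_class_const[OF assms(1)] A_class_det[OF assms(1)] assms(1)])
    fix i j assume "i < N - 1" "j < N - 1"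
    then show "(\<lambda>z. b z i j) \<in> A_class \<beta>" unfolding b_def by (intro assms(2)) auto
  qed
  ultimately show ?thesis by simp
qed

text \<open>
  Column \<open>q\<close> of the cofactor matrix pairs with column \<open>j\<close> of
  \<open>A\<close> to the determinant if \<open>j = q\<close>, and to 0 otherwise.
\<close>

lemma cofactor_expansion_column_combination:
  fixes A :: "'a :: comm_ring_1 mat"
  assumes A: "A \<in> carrier_mat N N" and q: "q < N"
  shows "(\<Sum>i<N. (\<Sum>j<N. c j * A $$ (i, j)) * cofactor A i q) = c q * Determinant.det A"
proof -
  have ortho: "(\<Sum>i<N. A $$ (i, j) * cofactor A i q) = (if j = q then Determinant.det A else 0)" if "j < N" for j
  proof -
    have "(adj_mat A * A) $$ (q, j) = (Determinant.det A \<cdot>\<^sub>m 1\<^sub>m N) $$ (q, j)"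
      using adj_mat(3)[OF A] by simp
    then have "(\<Sum>i = 0..<N. cofactor A i q * A $$ (i, j)) = (if j = q then Determinant.det A else 0)"
      using A q that by (auto simp: adj_mat_def scalar_prod_def)
    then show ?thesis by (simp add: atLeast0LessThan mult.commute)
  qed
  have "(\<Sum>i<N. (\<Sum>j<N. c j * A $$ (i, j)) * cofactor A i q) =
      (\<Sum>j<N. c j * (\<Sum>i<N. A $$ (i, j) * cofactor A i q))"
    by (simp add: sum_distrib_left sum_distrib_right mult.assoc) (rule sum.swap)
  also have "\<dots> = (\<Sum>j<N. if j = q then c q * Determinant.det A else 0)"
    by (rule sum.cong) (auto simp: ortho)
  finally show ?thesis using q by simp
qed

lemma higher_deriv_sum_cmult:
  assumes "\<And>j. j \<in> J \<Longrightarrow> f j holomorphic_on S" "open S" "z \<in> S"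
  shows "(deriv ^^ i) (\<lambda>z. \<Sum>j\<in>J. c j * f j z) z = (\<Sum>j\<in>J. c j * (deriv ^^ i) (f j) z)"
  using assms(1)
proof (induction J rule: infinite_finite_induct)
  case (insert j J)
  have "(deriv ^^ i) (\<lambda>z. c j * f j z + (\<Sum>j\<in>J. c j * f j z)) z =
      (deriv ^^ i) (\<lambda>z. c j * f j z) z + (deriv ^^ i) (\<lambda>z. \<Sum>j\<in>J. c j * f j z) z"
    using insert.prems assms by (intro higher_deriv_add[of _ S] holomorphic_intros) auto
  with insert assms show ?case by (simp add: higher_deriv_cmult[of _ S])
qed (simp_all add: higher_deriv_const)

theorem theorem3p2:
  fixes n :: nat and \<alpha> :: real
    and f :: "nat \<Rightarrow> complex \<Rightarrow> complex" and c :: "nat \<Rightarrow> complex"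
    and g \<theta> :: "complex \<Rightarrow> complex"
  assumes "real n < \<alpha>"
    and "\<And>j. j \<le> n \<Longrightarrow> f j \<in> A_class \<alpha>"
    and "lin_indep_on_disc n f"
    and "\<And>z. z \<in> ball 0 1 \<Longrightarrow> g z = (\<Sum>j\<le>n. c j * f j z)"
    and "\<exists>j\<le>n. c j \<noteq> 0"
    and "inner_function \<theta>"
    and "strongly_multipliable \<alpha> g \<theta>"
  shows "strongly_multipliable (\<alpha> - real n) (wronskian n f) \<theta>"
proof -
  define \<beta> where "\<beta> = \<alpha> - real n"
  have \<beta>: "\<beta> > 0" using assms(1) by (simp add: \<beta>_def)
  obtain q where q: "q \<le> n" "c q \<noteq> 0" using assms(5) by blast
  have g: "g \<in> A_class \<alpha>" using assms(7) by (simp add: strongly_multipliable_def)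
  have g\<theta>: "(\<lambda>z. g z * \<theta> z ^ k) \<in> A_class \<alpha>" for k
  proof (cases "k = 0")
    case False
    with assms(7) show ?thesis unfolding strongly_multipliable_def by blast
  qed (use g in simp)
  have holg: "g holomorphic_on ball 0 1" by (rule A_class_holomorphic[OF g])
  have holf: "f j holomorphic_on ball 0 1" if "j \<le> n" for j
    by (rule A_class_holomorphic[OF assms(2)[OF that]])
  have entries: "(\<lambda>z. (deriv ^^ i) (f j) z) \<in> A_class \<beta>" if "i < Suc n" "j < Suc n" for i j
    using A_class_mono[OF A_class_higher_deriv[OF assms(2), of j i], of \<beta>] that \<beta> assms(1)
    by (auto simp: \<beta>_def)
  have gentries: "(\<lambda>z. (deriv ^^ i) g z * \<theta> z ^ k) \<in> A_class \<beta>" if "i < Suc n" for i k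
    using A_class_mono[OF higher_deriv_times_inner_powers[OF holg assms(6) g\<theta>, of i k], of \<beta>] that \<beta> assms(1)
    by (auto simp: \<beta>_def)
  define W where "W z = mat (Suc n) (Suc n) (\<lambda>(i, j). (deriv ^^ i) (f j) z)" for z
  have expand: "c q * wronskian n f z = (\<Sum>i<Suc n. (deriv ^^ i) g z * cofactor (W z) i q)"
    if z: "z \<in> ball 0 1" for z
  proof -
    have "(deriv ^^ i) g z = (\<Sum>j<Suc n. c j * W z $$ (i, j))" if "i < Suc n" for i
    proof -
      have "(deriv ^^ i) g z = (deriv ^^ i) (\<lambda>z. \<Sum>j\<le>n. c j * f j z) z"
        using holg z holf assms(4)
        by (intro higher_deriv_transform_within_open[of g "ball 0 1"] holomorphic_intros) auto
      also have "\<dots> = (\<Sum>j\<le>n. c j * (deriv ^^ i) (f j) z)"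
        using holf z by (intro higher_deriv_sum_cmult[of _ _ "ball 0 1"]) auto
      also have "\<dots> = (\<Sum>j<Suc n. c j * W z $$ (i, j))"
        unfolding lessThan_Suc_atMost using that by (intro sum.cong) (auto simp: W_def)
      finally show ?thesis .
    qed
    then have "(\<Sum>i<Suc n. (deriv ^^ i) g z * cofactor (W z) i q) =
        (\<Sum>i<Suc n. (\<Sum>j<Suc n. c j * W z $$ (i, j)) * cofactor (W z) i q)"
      by (intro sum.cong) auto
    also have "\<dots> = c q * Determinant.det (W z)"
      using q by (intro cofactor_expansion_column_combination) (auto simp: W_def)
    finally show ?thesis by (simp add: wronskian_def W_def)
  qed
  have W\<theta>: "(\<lambda>z. wronskian n f z * \<theta> z ^ k) \<in> A_class \<beta>" for k
  proof -
    have cof: "(\<lambda>z. cofactor (W z) i q) \<in> A_class \<beta>" if "i < Suc n" for i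
      unfolding W_def using \<beta> that q entries by (intro A_class_cofactor) auto
    have "(\<lambda>z. \<Sum>i<Suc n. ((deriv ^^ i) g z * \<theta> z ^ k) * cofactor (W z) i q) \<in> A_class \<beta>"
    proof (rule A_class_sum[OF \<beta>])
      fix i assume "i \<in> {..<Suc n}"
      then show "(\<lambda>z. ((deriv ^^ i) g z * \<theta> z ^ k) * cofactor (W z) i q) \<in> A_class \<beta>"
        using A_class_mult[OF gentries[of i k] cof[of i] \<beta>] by auto
    qed
    from A_class_mult[OF A_class_const[OF \<beta>] this \<beta>, of "1 / c q"]
    have "(\<lambda>z. 1 / c q * (\<Sum>i<Suc n. ((deriv ^^ i) g z * \<theta> z ^ k) * cofactor (W z) i q)) \<in> A_class \<beta>" .
    then show ?thesis
    proof (rule A_class_cong)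
      fix z :: complex assume z: "z \<in> ball 0 1"
      have "(\<Sum>i<Suc n. ((deriv ^^ i) g z * \<theta> z ^ k) * cofactor (W z) i q) =
          (\<Sum>i<Suc n. (deriv ^^ i) g z * cofactor (W z) i q) * \<theta> z ^ k"
        unfolding sum_distrib_right by (intro sum.cong) (auto simp: mult_ac)
      also have "\<dots> = c q * wronskian n f z * \<theta> z ^ k" by (simp only: expand[OF z])
      finally show "1 / c q * (\<Sum>i<Suc n. ((deriv ^^ i) g z * \<theta> z ^ k) * cofactor (W z) i q) =
          wronskian n f z * \<theta> z ^ k"
        using q by simp
    qed
  qed
  from W\<theta>[of 0] W\<theta> \<beta> assms(6) show ?thesis
    by (simp add: strongly_multipliable_def \<beta>_def)
qed


end
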